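(* Let $n\ge1$ and $0<\varphi<t<1$ with $nt$ an integer. Define $$\mathrm{lE}_n(t|\varphi)=\min\left((t-\varphi)\sqrt{\frac{\pi n}{8\varphi(1-\varphi)}},\,1\right),\qquad Z=Y\!\left(\sqrt{\frac{n}{\varphi(1-\varphi)}}(t-\varphi)\right).$$ Then $$-\log P_{\mathrm{X},n}(t|\varphi)\in-\log P_{\mathrm{PBR},n}(t|\varphi)+\log(n+1)-\log\left(t\sqrt{\frac{1-\varphi}{\varphi}}\right)-\log\big(\sqrt n\,Z\big)+\left[-\frac{\mathrm{lE}_n(t|\varphi)}{n(t-\varphi)},0\right],$$ $$-\log P_{\mathrm{X},n}(t|\varphi)\in-\log P_{\mathrm{CH},n}(t|\varphi)+\tfrac12\log n-\log\left(\sqrt{\frac{t(1-\varphi)}{2\pi(1-t)\varphi}}\right)-\log\big(\sqrt n\,Z\big)+\left[-\frac{\mathrm{lE}_n(t|\varphi)}{n(t-\varphi)},\frac{1}{12nt(1-t)}\right].$$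
   Context: Logarithms are natural. $Y(x)=e^{x^2/2}\int_x^\infty e^{-s^2/2}\,ds$ for $x\ge0$. For an integer $n\ge1$, $0<\varphi<1$ and $t\in[0,1]$ with $nt$ an integer: $P_{\mathrm{X},n}(t|\varphi)=\sum_{k\ge nt}\binom{n}{k}\varphi^k(1-\varphi)^{n-k}$; $P_{\mathrm{CH},n}(t|\varphi)=\left(\frac{\varphi}{t}\right)^{nt}\left(\frac{1-\varphi}{1-t}\right)^{n(1-t)}$ if $t\ge\varphi$, and $=1$ otherwise; $P_{\mathrm{PBR},n}(t|\varphi)=\varphi^{nt}(1-\varphi)^{n(1-t)}(n+1)\binom{n}{nt}$ if $t\ge\varphi$, and $=t^{nt}(1-t)^{n(1-t)}(n+1)\binom{n}{nt}$ otherwise. Interval notation: $x\in y+[u,v]$ means $y+u\le x\le y+v$. *)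

theory Defs
  imports "HOL-Analysis.Analysis"
begin

definition Yfun :: "real \<Rightarrow> real" where
  "Yfun x = exp (x\<^sup>2 / 2) * (LBINT s:{x..}. exp (- (s\<^sup>2) / 2))"

text \<open>Probabilities with t = k/n, i.e. nt = k is an integer.\<close>
definition P_X :: "nat \<Rightarrow> nat \<Rightarrow> real \<Rightarrow> real" where
  "P_X n k \<phi> = (\<Sum>j\<in>{k..n}. real (n choose j) * \<phi> ^ j * (1 - \<phi>) ^ (n - j))"

definition P_CH :: "nat \<Rightarrow> nat \<Rightarrow> real \<Rightarrow> real" where
  "P_CH n k \<phi> = (let t = real k / real n in
     if t \<ge> \<phi> then (\<phi> / t) powr (real n * t) * ((1 - \<phi>) / (1 - t)) powr (real n * (1 - t))
     else 1)"

definition P_PBR :: "nat \<Rightarrow> nat \<Rightarrow> real \<Rightarrow> real" where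
  "P_PBR n k \<phi> = (let t = real k / real n in
     if t \<ge> \<phi> then \<phi> ^ k * (1 - \<phi>) ^ (n - k) * (real n + 1) * real (n choose k)
     else t ^ k * (1 - t) ^ (n - k) * (real n + 1) * real (n choose k))"

definition lE :: "nat \<Rightarrow> real \<Rightarrow> real \<Rightarrow> real" where
  "lE n t \<phi> = min ((t - \<phi>) * sqrt (pi * real n / (8 * \<phi> * (1 - \<phi>)))) 1"

end

theory Submission
  imports Defs "HOL-Probability.Distributions" "HOL-Real_Asymp.Real_Asymp"
begin

text \<open>
  Write \<open>q = 1 - p\<close>, \<open>\<sigma> = sqrt (n p q)\<close>, \<open>x = (k - n p) / \<sigma>\<close>, and let \<open>b\<close> be the point probability at \<open>k - 1\<close>
  of the binomial law with parameters \<open>n - 1\<close> and \<open>p\<close>. The main term of both expansions is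
  \<open>F = \<sigma> b Y(x)\<close>. Regard it and the tail \<open>R = P\<^sub>X\<close> as functions of \<open>p \<in> (0, \<phi>]\<close>;
  both tend to \<open>0\<close> as \<open>p \<rightarrow> 0\<close>, with \<open>R' = n b\<close> and \<open>F' = n b (1 - e)\<close>, where
  \<open>e = (Y(x) - (q - p) x (1 - x Y(x))) / (2 \<sigma>)\<close>. Since \<open>e \<ge> 0\<close>, comparing derivatives gives \<open>F \<le> R\<close>.
  The bound \<open>R \<le> F exp e\<close> follows in the same way from \<open>\<sigma> Y(x) e' \<ge> n e\<^sup>2 / 2\<close>, because
  \<open>exp e (1 - e + e\<^sup>2 / 2) \<ge> 1\<close>; that inequality for \<open>e'\<close> rests on rational bounds for the Mills ratio \<open>Y\<close> and
  on \<open>1 \<le> k \<le> n - 1\<close>. Finally \<open>e\<close> is at most \<open>min (sqrt (pi / 8)) (1 / x) / \<sigma>\<close>. The second expansion is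
  the first one with Stirling's formula substituted for the binomial coefficient.
\<close>

section \<open>The Gaussian tail integral: value at 0, derivative, limit at infinity\<close>

definition gauss_tail :: "real \<Rightarrow> real" where
  "gauss_tail x = (LBINT s:{x..}. exp (- (s\<^sup>2) / 2))"

text \<open>The substitution s / sqrt 2 reduces this to the half-line integral of exp (-s^2), which
  is sqrt pi / 2.\<close>

lemma has_bochner_integral_half_gauss:
  "has_bochner_integral lborel (\<lambda>s. indicator {0..} s *\<^sub>R exp (- (s\<^sup>2) / 2)) (sqrt (pi / 2))"
proof -
  have "has_bochner_integral lborel (\<lambda>x. indicator {0..} (0 + (1 / sqrt 2) * x) *\<^sub>R exp (- (0 + (1 / sqrt 2) * x)\<^sup>2))
     ((sqrt pi / 2) /\<^sub>R \<bar>1 / sqrt 2\<bar>)"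
    using gaussian_moment_0
    by (subst lborel_has_bochner_integral_real_affine_iff[symmetric]) auto
  moreover have "(\<lambda>x::real. indicator {0..} (0 + (1 / sqrt 2) * x) *\<^sub>R exp (- (0 + (1 / sqrt 2) * x)\<^sup>2))
     = (\<lambda>s. indicator {0..} s *\<^sub>R exp (- (s\<^sup>2) / 2))"
    by (auto simp: fun_eq_iff power_divide indicator_def zero_le_divide_iff)
  moreover have "(sqrt pi / 2) /\<^sub>R \<bar>1 / sqrt 2\<bar> = sqrt (pi / 2)"
    by (simp add: real_sqrt_divide field_simps)
  ultimately show ?thesis by simp
qed

lemma integrable_gauss: "integrable lborel (\<lambda>s::real. exp (- (s\<^sup>2) / 2))"
proof -
  have "has_bochner_integral lborel (\<lambda>s::real. exp (- (s\<^sup>2) / 2)) (2 *\<^sub>R sqrt (pi / 2))"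
    by (rule has_bochner_integral_even_function[OF has_bochner_integral_half_gauss]) simp
  then show ?thesis by (simp add: has_bochner_integral_iff)
qed

lemma set_integrable_gauss: "S \<in> sets borel \<Longrightarrow> set_integrable lborel S (\<lambda>s::real. exp (- (s\<^sup>2) / 2))"
  unfolding set_integrable_def by (rule integrable_mult_indicator) (use integrable_gauss in auto)

lemma gauss_tail_0: "gauss_tail 0 = sqrt (pi / 2)"
  using has_bochner_integral_half_gauss
  unfolding gauss_tail_def set_lebesgue_integral_def has_bochner_integral_iff by simp

text \<open>Cutting at a fixed \<open>b\<close> leaves a proper integral, to which the fundamental
  theorem applies, plus a constant.\<close>

lemma gauss_tail_split:
  assumes "z \<le> b"
  shows "gauss_tail z = integral {z..b} (\<lambda>s. exp (- (s\<^sup>2) / 2)) + (LBINT s:{b<..}. exp (- (s\<^sup>2) / 2))"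
proof -
  have "{z..} = {z..b} \<union> {b<..}" using assms by auto
  then show ?thesis unfolding gauss_tail_def
    by (subst set_borel_integral_eq_integral(2)[symmetric], intro set_integrable_gauss, simp)
       (simp only:, intro set_integral_Un set_integrable_gauss, auto)
qed

lemma has_real_derivative_gauss_tail:
  "(gauss_tail has_real_derivative - exp (- (x\<^sup>2) / 2)) (at x)"
proof -
  let ?f = "\<lambda>s::real. exp (- (s\<^sup>2) / 2)"
  have "((\<lambda>z. integral {z..x+1} ?f) has_real_derivative - ?f x) (at x within {x-1..x+1})"
    by (rule integral_has_real_derivative') (auto intro!: continuous_intros)
  then have "((\<lambda>z. integral {z..x+1} ?f) has_real_derivative - ?f x) (at x)"
    by (simp add: at_within_Icc_at)
  then have D: "((\<lambda>z. integral {z..x+1} ?f + (LBINT s:{x+1<..}. ?f s)) has_real_derivative - ?f x) (at x)"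
    using DERIV_add[OF _ DERIV_const] by force
  show ?thesis
  \<comment> \<open>The cut sits at x + 1, so the splitting is valid for every z within distance 1
    of x.\<close>
  proof (rule has_field_derivative_transform_within[OF D, of 1])
    show "integral {z..x+1} ?f + (LBINT s:{x+1<..}. ?f s) = gauss_tail z" if "dist z x < 1" for z
      using that by (intro gauss_tail_split[symmetric]) (simp add: dist_real_def)
  qed auto
qed

lemma tendsto_gauss_tail: "(gauss_tail \<longlongrightarrow> 0) at_top"
proof -
  have "((\<lambda>x. LINT s|lborel. indicator {x..} s *\<^sub>R exp (- (s\<^sup>2) / 2)) \<longlongrightarrow> (LINT (s::real)|lborel. (0::real))) at_top"
  proof (rule integral_dominated_convergence_at_top[where w="\<lambda>s. exp (- (s\<^sup>2) / 2)"])
    show "AE s in lborel. ((\<lambda>x::real. indicator {x..} s *\<^sub>R exp (- (s\<^sup>2) / 2)::real) \<longlongrightarrow> 0) at_top"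
    proof (rule AE_I2)
      fix s :: real
      show "((\<lambda>x::real. indicator {x..} s *\<^sub>R exp (- (s\<^sup>2) / 2)::real) \<longlongrightarrow> 0) at_top"
        by (rule tendsto_eventually) (use eventually_gt_at_top[of s] in eventually_elim, auto)
    qed
      show "\<forall>\<^sub>F x in at_top. AE s in lborel. norm (indicator {x..} s *\<^sub>R exp (- (s\<^sup>2) / 2) :: real) \<le> exp (- (s\<^sup>2) / 2)"
      by (intro always_eventually allI AE_I2) (simp add: indicator_def)
  qed (measurable, rule integrable_gauss)
  then show ?thesis
    unfolding gauss_tail_def[abs_def] set_lebesgue_integral_def by simp
qed

text \<open>A nonincreasing function is never below its limit at infinity.\<close>

lemma tail_comparison:
  fixes h h' :: "real \<Rightarrow> real"
  assumes "\<And>x. x \<ge> a \<Longrightarrow> (h has_real_derivative h' x) (at x)" "\<And>x. x \<ge> a \<Longrightarrow> h' x \<le> 0"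
    and "(h \<longlongrightarrow> 0) at_top"
  shows "h a \<ge> 0"
proof (rule tendsto_upperbound[OF assms(3)])
  show "\<forall>\<^sub>F x in at_top. h x \<le> h a"
    using eventually_ge_at_top[of a]
  proof eventually_elim
    case (elim x)
    then show ?case
      by (rule DERIV_nonpos_imp_nonincreasing) (rule exI, rule conjI[OF assms(1,2)])
  qed
qed simp

section \<open>The Mills ratio Y: differential equation and rational bounds\<close>

lemma Yfun_eq: "Yfun x = exp (x\<^sup>2 / 2) * gauss_tail x"
  by (simp add: Yfun_def gauss_tail_def)

lemma Yfun_0: "Yfun 0 = sqrt (pi / 2)"
  by (simp add: Yfun_eq gauss_tail_0)

lemma has_real_derivative_Yfun: "(Yfun has_real_derivative x * Yfun x - 1) (at x)"
proof -
  have "((\<lambda>x. exp (x\<^sup>2 / 2) * gauss_tail x) has_real_derivative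
     exp (x\<^sup>2 / 2) * x * gauss_tail x + exp (x\<^sup>2 / 2) * (- exp (- (x\<^sup>2) / 2))) (at x)"
    by (auto intro!: derivative_eq_intros has_real_derivative_gauss_tail simp: algebra_simps)
  moreover have "exp (x\<^sup>2 / 2) * (- exp (- (x\<^sup>2) / 2)) = -1"
    by (simp add: exp_minus)
  ultimately show ?thesis
    unfolding Yfun_eq[abs_def] by (simp add: algebra_simps)
qed

lemma Yfun_pos: "0 < Yfun x"
proof -
  have "0 < gauss_tail x"
    by (rule DERIV_neg_imp_decreasing_at_top[OF _ tendsto_gauss_tail])
       (use has_real_derivative_gauss_tail in force)
  then show ?thesis by (simp add: Yfun_eq)
qed

text \<open>If \<open>G\<close> satisfies the differential inequality \<open>G' \<le> x G - 1\<close> then \<open>(G - Y) exp (- x\<^sup>2 / 2)\<close>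
  decreases to \<open>0\<close>.\<close>

lemma Yfun_le:
  fixes G G' :: "real \<Rightarrow> real"
  assumes "\<And>x. x \<ge> a \<Longrightarrow> (G has_real_derivative G' x) (at x)" "\<And>x. x \<ge> a \<Longrightarrow> G' x \<le> x * G x - 1"
    and "((\<lambda>x. G x * exp (- (x\<^sup>2) / 2)) \<longlongrightarrow> 0) at_top"
  shows "Yfun a \<le> G a"
proof -
  let ?h = "\<lambda>x. G x * exp (- (x\<^sup>2) / 2) - gauss_tail x"
  have "?h a \<ge> 0"
  proof (rule tail_comparison[where a=a and h="?h" and h' = "\<lambda>x. (G' x - x * G x + 1) * exp (- (x\<^sup>2) / 2)"])
    show "(?h has_real_derivative (G' x - x * G x + 1) * exp (- (x\<^sup>2) / 2)) (at x)" if "x \<ge> a" for x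
      by (auto intro!: derivative_eq_intros assms(1) has_real_derivative_gauss_tail that simp: algebra_simps)
    show "(?h \<longlongrightarrow> 0) at_top"
      using tendsto_diff[OF assms(3) tendsto_gauss_tail] by simp
    show "(G' x - x * G x + 1) * exp (- (x\<^sup>2) / 2) \<le> 0" if "x \<ge> a" for x
      using assms(2)[OF that] by (simp add: mult_le_0_iff)
  qed
  then have "exp (a\<^sup>2 / 2) * gauss_tail a \<le> exp (a\<^sup>2 / 2) * (G a * exp (- (a\<^sup>2) / 2))"
    by (intro mult_left_mono) auto
  then show ?thesis by (simp add: Yfun_eq exp_minus field_simps)
qed

lemma le_Yfun:
  fixes G G' :: "real \<Rightarrow> real"
  assumes "\<And>x. x \<ge> a \<Longrightarrow> (G has_real_derivative G' x) (at x)" "\<And>x. x \<ge> a \<Longrightarrow> G' x \<ge> x * G x - 1"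
    and "((\<lambda>x. G x * exp (- (x\<^sup>2) / 2)) \<longlongrightarrow> 0) at_top"
  shows "G a \<le> Yfun a"
proof -
  let ?h = "\<lambda>x. gauss_tail x - G x * exp (- (x\<^sup>2) / 2)"
  have "?h a \<ge> 0"
  proof (rule tail_comparison[where a=a and h="?h" and h' = "\<lambda>x. (x * G x - 1 - G' x) * exp (- (x\<^sup>2) / 2)"])
    show "(?h has_real_derivative (x * G x - 1 - G' x) * exp (- (x\<^sup>2) / 2)) (at x)" if "x \<ge> a" for x
      by (auto intro!: derivative_eq_intros assms(1) has_real_derivative_gauss_tail that simp: algebra_simps)
    show "(?h \<longlongrightarrow> 0) at_top"
      using tendsto_diff[OF tendsto_gauss_tail assms(3)] by simp
    show "(x * G x - 1 - G' x) * exp (- (x\<^sup>2) / 2) \<le> 0" if "x \<ge> a" for x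
      using assms(2)[OF that] by (simp add: mult_le_0_iff)
  qed
  then have "exp (a\<^sup>2 / 2) * gauss_tail a \<ge> exp (a\<^sup>2 / 2) * (G a * exp (- (a\<^sup>2) / 2))"
    by (intro mult_left_mono) auto
  then show ?thesis by (simp add: Yfun_eq exp_minus field_simps)
qed

text \<open>The test function satisfies x G - 1 = -1 / (1 + x^2), which is at most G'. The bound
  amounts to \<open>mills_M\<close> being nonnegative.\<close>

lemma Yfun_lower:
  assumes "x \<ge> 0" shows "x / (1 + x\<^sup>2) \<le> Yfun x"
proof (rule le_Yfun[where a=x and G = "\<lambda>x. x / (1 + x\<^sup>2)" and G' = "\<lambda>x. (1 - x\<^sup>2) / (1 + x\<^sup>2)\<^sup>2"])
  fix y :: real
  have pos: "0 < 1 + y\<^sup>2" by (simp add: add_pos_nonneg)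
  show "((\<lambda>x. x / (1 + x\<^sup>2)) has_real_derivative (1 - y\<^sup>2) / (1 + y\<^sup>2)\<^sup>2) (at y)"
    using pos by (auto intro!: derivative_eq_intros simp: power2_eq_square field_simps)
  have "y * (y / (1 + y\<^sup>2)) - 1 = - (1 + y\<^sup>2) / (1 + y\<^sup>2)\<^sup>2"
    using pos by (simp add: power2_eq_square divide_simps)
  moreover have "- (1 + y\<^sup>2) / (1 + y\<^sup>2)\<^sup>2 \<le> (1 - y\<^sup>2) / (1 + y\<^sup>2)\<^sup>2"
    by (rule divide_right_mono) auto
  ultimately show "(1 - y\<^sup>2) / (1 + y\<^sup>2)\<^sup>2 \<ge> y * (y / (1 + y\<^sup>2)) - 1"
    by simp
next
  show "((\<lambda>x::real. x / (1 + x\<^sup>2) * exp (- (x\<^sup>2) / 2)) \<longlongrightarrow> 0) at_top"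
    by real_asymp
qed

text \<open>For G = 1 / x the right side x G - 1 is 0 while G' is negative. The bound amounts to
  \<open>mills_D\<close> being nonnegative.\<close>

lemma Yfun_upper:
  assumes "x > 0" shows "Yfun x \<le> 1 / x"
proof (rule Yfun_le[where a=x and G = "\<lambda>x. 1 / x" and G' = "\<lambda>x. - 1 / x\<^sup>2"])
  fix y :: real assume "x \<le> y"
  then have "y > 0" using assms by simp
  then show "((/) 1 has_real_derivative - 1 / y\<^sup>2) (at y)" "- 1 / y\<^sup>2 \<le> y * (1 / y) - 1"
    by (auto intro!: derivative_eq_intros simp: power2_eq_square)
next
  show "((\<lambda>x::real. 1 / x * exp (- (x\<^sup>2) / 2)) \<longlongrightarrow> 0) at_top"
    by real_asymp
qed

text \<open>With \<open>D = 1 - x Y\<close> and \<open>M = Y - x D\<close>, this is a rearrangement of \<open>3 M / (x + 2) \<le> 2 D - x M\<close>.\<close>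

lemma Yfun_upper_rational:
  assumes "x \<ge> 0"
  shows "Yfun x \<le> (x^3 + 2*x\<^sup>2 + 5*x + 4) / (x^4 + 2*x^3 + 6*x\<^sup>2 + 6*x + 3)"
proof -
  define N where "N = (\<lambda>x::real. x^3 + 2*x\<^sup>2 + 5*x + 4)"
  define N' where "N' = (\<lambda>x::real. 3*x\<^sup>2 + 4*x + 5)"
  define Q where "Q = (\<lambda>x::real. x^4 + 2*x^3 + 6*x\<^sup>2 + 6*x + 3)"
  define Q' where "Q' = (\<lambda>x::real. 4*x^3 + 6*x\<^sup>2 + 12*x + 6)"
  have "Yfun x \<le> N x / Q x"
  proof (rule Yfun_le[where a=x and G = "\<lambda>x. N x / Q x" and G' = "\<lambda>x. (N' x * Q x - N x * Q' x) / (Q x * Q x)"])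
    fix y :: real assume "x \<le> y"
    then have y: "y \<ge> 0" using assms by simp
    then have Q: "Q y > 0" unfolding Q_def by (intro add_nonneg_pos) auto
    have "(N has_real_derivative N' y) (at y)" "(Q has_real_derivative Q' y) (at y)"
      unfolding N_def N'_def Q_def Q'_def
      by (auto intro!: derivative_eq_intros simp: power2_eq_square algebra_simps)
    then show "((\<lambda>x. N x / Q x) has_real_derivative (N' y * Q y - N y * Q' y) / (Q y * Q y)) (at y)"
      using Q by (intro DERIV_divide) auto
    \<comment> \<open>The slack in G' \<le> y G - 1 is exactly 12 y / Q^2.\<close>
    have "y * N y * Q y - Q y * Q y - (N' y * Q y - N y * Q' y) = 12 * y"
      unfolding N_def N'_def Q_def Q'_def by algebra
    then have "(N' y * Q y - N y * Q' y) / (Q y * Q y) \<le> (y * N y * Q y - Q y * Q y) / (Q y * Q y)"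
      using y by (intro divide_right_mono) auto
    then show "(N' y * Q y - N y * Q' y) / (Q y * Q y) \<le> y * (N y / Q y) - 1"
      using Q by (simp add: diff_divide_distrib)
  next
    show "((\<lambda>x. N x / Q x * exp (- (x\<^sup>2) / 2)) \<longlongrightarrow> 0) at_top"
      unfolding N_def Q_def by real_asymp
  qed
  then show ?thesis by (simp add: N_def Q_def)
qed

text \<open>By Y' = x Y - 1, these are D = -Y', A = -x Y' and M = Y''; moreover 2 D - x M = -Y'''.
  The splitting Y = M + A is used throughout.\<close>

definition mills_D :: "real \<Rightarrow> real" where "mills_D x = 1 - x * Yfun x"
definition mills_A :: "real \<Rightarrow> real" where "mills_A x = x * mills_D x"
definition mills_M :: "real \<Rightarrow> real" where "mills_M x = Yfun x - mills_A x"

lemma mills_D_nonneg: "x \<ge> 0 \<Longrightarrow> mills_D x \<ge> 0"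
  using Yfun_upper[of x] by (cases "x = 0") (auto simp: mills_D_def field_simps)

lemma mills_A_nonneg: "x \<ge> 0 \<Longrightarrow> mills_A x \<ge> 0"
  using mills_D_nonneg[of x] by (simp add: mills_A_def)

lemma mills_M_nonneg: assumes "x \<ge> 0" shows "mills_M x \<ge> 0"
proof -
  have "0 < 1 + x\<^sup>2" by (simp add: add_pos_nonneg)
  then have "x \<le> Yfun x * (1 + x\<^sup>2)"
    using Yfun_lower[OF assms] by (simp add: divide_le_eq)
  then show ?thesis
    by (simp add: mills_M_def mills_A_def mills_D_def algebra_simps power2_eq_square)
qed

text \<open>Multiplied by x + 2, the difference of the sides is the cleared form of the rational
  upper bound on Y. The denominator x + 2 is matched to the lower bound (x + 2) / 4 of
  \<open>drift_lower_bound\<close>.\<close>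

lemma mills_M_le_linear:
  assumes "x \<ge> 0"
  shows "3 * mills_M x / (x + 2) \<le> 2 * mills_D x - x * mills_M x"
proof -
  have "0 < x^4 + 2*x^3 + 6*x\<^sup>2 + 6*x + 3"
    using assms by (intro add_nonneg_pos) auto
  then have "Yfun x * (x^4 + 2*x^3 + 6*x\<^sup>2 + 6*x + 3) \<le> x^3 + 2*x\<^sup>2 + 5*x + 4"
    using Yfun_upper_rational[OF assms] by (simp add: le_divide_eq)
  moreover have "(2 * mills_D x - x * mills_M x) * (x + 2) - 3 * mills_M x
      = (x^3 + 2*x\<^sup>2 + 5*x + 4) - Yfun x * (x^4 + 2*x^3 + 6*x\<^sup>2 + 6*x + 3)"
    unfolding mills_M_def mills_A_def mills_D_def by algebra
  ultimately show ?thesis using assms by (simp add: divide_le_eq)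
qed

lemma mills_M_le_D:
  assumes "x \<ge> 0" shows "3 * mills_M x \<le> 4 * mills_D x"
proof -
  have "3 * mills_M x \<le> (2 * mills_D x - x * mills_M x) * (x + 2)"
    using mills_M_le_linear[OF assms] assms by (simp add: divide_le_eq)
  then have "(x\<^sup>2 + 2 * x + 3) * mills_M x \<le> 2 * (x + 2) * mills_D x"
    by (simp add: algebra_simps power2_eq_square)
  \<comment> \<open>The coefficients differ by x^2 + x / 2.\<close>
  moreover have "(3/2) * (x + 2) * mills_M x \<le> (x\<^sup>2 + 2 * x + 3) * mills_M x"
    using assms mills_M_nonneg[OF assms] by (intro mult_right_mono) (auto simp: algebra_simps)
  ultimately have "(x + 2) * (3 * mills_M x) \<le> (x + 2) * (4 * mills_D x)"
    by (simp add: algebra_simps)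
  then show ?thesis using assms by (simp only: mult_le_cancel_left_pos)
qed

section \<open>The algebraic inequality behind the growth of e\<close>

text \<open>The two bounds on \<open>U\<close> come from adding \<open>q\<close> times \<open>c1\<close> to \<open>p\<close> times \<open>c2\<close>, and from \<open>c2\<close>
  alone. Where neither suffices, \<open>d\<close> would violate \<open>6 d - 8 d\<^sup>3 \<le> 2\<close>, that is
  \<open>2 (2 d - 1)\<^sup>2 (d + 1) \<ge> 0\<close>.\<close>

lemma drift_lower_bound:
  fixes p q x u :: real
  assumes "0 < p" "p \<le> q" "p + q = 1" "x \<ge> 0" "u > 0"
    and c1: "u\<^sup>2 \<ge> q - q * x * u" and c2: "u\<^sup>2 \<ge> p + p * x * u"
  shows "(x + 2) / 4 \<le> u + x * (q - p) / 2"
proof -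
  define d where "d = q - p"
  define U where "U = u + x * d / 2"
  have pd: "p = (1 - d) / 2" "q = (1 + d) / 2" using assms(3) by (auto simp: d_def)
  have d: "0 \<le> d" "d < 1" using assms by (auto simp: d_def)
  have U0: "U > 0" using assms d by (simp add: U_def add_pos_nonneg)
  have "q * u\<^sup>2 + p * u\<^sup>2 \<ge> q * (q - q * x * u) + p * (p + p * x * u)"
    using assms by (intro add_mono mult_left_mono) auto
  then have "q * u\<^sup>2 + p * u\<^sup>2 + d * x * u \<ge> q\<^sup>2 + p\<^sup>2"
    unfolding pd by (simp add: field_simps power2_eq_square)
  moreover have "q * u\<^sup>2 + p * u\<^sup>2 = u\<^sup>2" using assms(3) by (metis distrib_right mult_1 add.commute)
  moreover have "U\<^sup>2 = u\<^sup>2 + d * x * u + d\<^sup>2 * x\<^sup>2 / 4"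
    by (simp add: U_def power2_eq_square field_simps)
  moreover have "q\<^sup>2 + p\<^sup>2 = 1/2 + d\<^sup>2 / 2" unfolding pd by (simp add: field_simps power2_eq_square)
  ultimately have b1: "U\<^sup>2 \<ge> 1/2 + d\<^sup>2 / 4 * (x\<^sup>2 + 2)"
    by (simp add: field_simps)
  \<comment> \<open>\<open>c2\<close> gives u^2 - p x u \<ge> p > 0.\<close>
  have "u * (u - p * x) > 0" using c2 assms(1) by (simp add: power2_eq_square algebra_simps)
  then have ux: "u - p * x > 0" using assms(5) by (simp add: zero_less_mult_iff)
  have "U\<^sup>2 - (p + x\<^sup>2 / 4) = (u\<^sup>2 - p - p * x * u) + q * x * (u - p * x)"
    unfolding U_def pd by (simp add: field_simps power2_eq_square)
  moreover have "q * x * (u - p * x) \<ge> 0" using ux assms by simp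
  ultimately have b2: "U\<^sup>2 \<ge> p + x\<^sup>2 / 4" using c2 by linarith
  \<comment> \<open>This intermediate target exceeds the square of (x + 2) / 4 by (x - 1)^2 / 8, and
    its factor x^2 + 2 is the one in \<open>b1\<close>.\<close>
  have "U\<^sup>2 \<ge> 3/16 * (x\<^sup>2 + 2)"
  proof (cases "x\<^sup>2 + 2 \<ge> 8 * d \<or> d\<^sup>2 \<ge> 3/4")
    case True
    then show ?thesis
    proof
      assume "x\<^sup>2 + 2 \<ge> 8 * d"
      then show ?thesis using b2 pd by (simp add: field_simps)
    next
      assume "d\<^sup>2 \<ge> 3/4"
      then have "d\<^sup>2 / 4 * (x\<^sup>2 + 2) \<ge> (3/4) / 4 * (x\<^sup>2 + 2)" by (intro mult_right_mono) auto
      then show ?thesis using b1 by simp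
    qed
  next
    case False
    then have "(3/4 - d\<^sup>2) * (x\<^sup>2 + 2) \<le> (3/4 - d\<^sup>2) * (8 * d)"
      by (intro mult_left_mono) auto
    also have "\<dots> = 2 - 2 * (2 * d - 1)\<^sup>2 * (d + 1)"
      by (simp add: algebra_simps power2_eq_square)
    also have "\<dots> \<le> 2" using d by simp
    finally have "3 * (x\<^sup>2 + 2) \<le> 8 + 4 * (d\<^sup>2 * (x\<^sup>2 + 2))" by (simp add: algebra_simps)
    moreover have "8 + 4 * (d\<^sup>2 * (x\<^sup>2 + 2)) \<le> 16 * U\<^sup>2" using b1 by simp
    ultimately show ?thesis by simp
  qed
  moreover have "3/16 * (x\<^sup>2 + 2) - ((x + 2) / 4)\<^sup>2 = (x - 1)\<^sup>2 / 8"
    by (simp add: field_simps power2_eq_square)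
  moreover have "(x - 1)\<^sup>2 / 8 \<ge> 0" by simp
  ultimately have "((x + 2) / 4)\<^sup>2 \<le> U\<^sup>2" by linarith
  then show ?thesis using U0 power2_le_imp_le[of "(x+2)/4" U] by (simp add: U_def d_def)
qed

text \<open>This is \<open>e'_bound\<close> with denominators cleared and y = 1 / \<sigma>; there
  \<open>c1\<close> and \<open>c2\<close> express k \<ge> 1 and k \<le> n - 1. For p \<le> q one
  interpolates linearly in d; for p > q only the M^2 term on the left can be positive.\<close>

lemma core_inequality:
  fixes p q x y :: real
  assumes "0 < p" "0 < q" "p + q = 1" "x \<ge> 0" "y > 0"
    and c1: "q * (y\<^sup>2 - x * y) \<le> 1" and c2: "p * (y\<^sup>2 + x * y) \<le> 1"
  defines "d \<equiv> q - p"
  defines "Y \<equiv> Yfun x" and "D \<equiv> mills_D x" and "A \<equiv> mills_A x" and "M \<equiv> mills_M x"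
  shows "(3/4 - p) * M\<^sup>2 + (1/2 - p) * M * A - p * q * A\<^sup>2
       \<le> Y * (D + d * (D - x * M)) * (1 / y + x * d / 2)"
proof -
  define u where "u = 1 / y"
  define U where "U = u + x * d / 2"
  define T where "T = 2 * D - x * M"
  have u: "u > 0" using assms(5) by (simp add: u_def)
  have q: "q = 1 - p" and d: "d = 1 - 2 * p" using assms(3) by (auto simp: d_def)
  have Y: "Y > 0" unfolding Y_def by (rule Yfun_pos)
  have D: "D \<ge> 0" and A: "A \<ge> 0" and M: "M \<ge> 0"
    using assms(4) by (auto simp: D_def A_def M_def mills_D_nonneg mills_A_nonneg mills_M_nonneg)
  have YMA: "Y = M + A" by (simp add: M_def A_def Y_def mills_M_def)
  have MD: "3 * M \<le> 4 * D" using assms(4) mills_M_le_D by (simp add: M_def D_def)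
  have T: "3 * M / (x + 2) \<le> T" using mills_M_le_linear[OF assms(4)] by (simp add: T_def M_def D_def)
  then have T0: "T \<ge> 0" using M assms(4) by (meson divide_nonneg_pos order_trans mult_nonneg_nonneg add_nonneg_pos zero_le_numeral zero_less_numeral)
  have yu: "y = 1 / u" by (simp add: u_def)
  have "u\<^sup>2 * (q * (y\<^sup>2 - x * y)) = q - q * x * u"
    using u unfolding yu by (simp add: field_simps power2_eq_square)
  then have c1': "u\<^sup>2 \<ge> q - q * x * u"
    using mult_left_mono[OF c1, of "u\<^sup>2"] by simp
  have "u\<^sup>2 * (p * (y\<^sup>2 + x * y)) = p + p * x * u"
    using u unfolding yu by (simp add: field_simps power2_eq_square)
  then have c2': "u\<^sup>2 \<ge> p + p * x * u"
    using mult_left_mono[OF c2, of "u\<^sup>2"] by simp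
  have "(3/4 - p) * M\<^sup>2 + (1/2 - p) * M * A - p * q * A\<^sup>2
       \<le> Y * (D + d * (D - x * M)) * U"
  proof (cases "p \<le> q")
    case True
    have U: "U \<ge> (x + 2) / 4"
      unfolding U_def d_def by (rule drift_lower_bound) (use assms True u c1' c2' in auto)
    then have U2: "U \<ge> 1/2" using assms(4) by simp
    have "3/4 * M = 3 * M / (x + 2) * ((x + 2) / 4)"
      using assms(4) by simp
    also have "\<dots> \<le> T * U"
      using T T0 U assms(4) M by (intro mult_mono) auto
    finally have TU: "Y * (3/4 * M) \<le> Y * (T * U)" using Y by (intro mult_left_mono) auto
    \<comment> \<open>3 M \<le> 4 D and U \<ge> 1/2 give even 3 M / 8 \<le> D U.\<close>
    have "M / 4 \<le> (3/4 * M) * (1/2)" using M by simp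
    also have "\<dots> \<le> D * U" using MD M U2 D by (intro mult_mono) auto
    finally have DU: "Y * (M / 4) \<le> Y * (D * U)" using Y by (intro mult_left_mono) auto
    have d0: "0 \<le> d" "0 \<le> 1 - d" using True assms by (auto simp: d_def)
    have MY: "M * M \<le> M * Y" using M A YMA by (intro mult_left_mono) auto
    have "(3/4 - p) * M\<^sup>2 + (1/2 - p) * M * A - p * q * A\<^sup>2 \<le> (3/4 - p) * M\<^sup>2 + (1/2 - p) * M * A"
      using assms by simp
    \<comment> \<open>Both sides are affine in d, so the endpoints suffice: d = 0 needs
      \<open>DU\<close>, and d = 1 needs \<open>TU\<close>, each together with M \<le> Y.\<close>
    also have "\<dots> = (1 - d) * (M * M / 4) + d * (M * M / 4 + M * Y / 2)"
      unfolding d YMA by (simp add: field_simps power2_eq_square)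
    also have "\<dots> \<le> (1 - d) * (Y * (D * U)) + d * (Y * (T * U))"
      using DU TU MY by (intro add_mono mult_left_mono d0) (auto simp: algebra_simps)
    also have "\<dots> = Y * (D + d * (D - x * M)) * U"
      by (simp add: T_def algebra_simps)
    finally show ?thesis .
  next
    case False
    then have d0: "d \<le> 0" and p2: "p \<ge> 1/2" using assms by (auto simp: d_def)
    have ux: "u * (u - p * x) > 0" using c2' assms(1) by (simp add: power2_eq_square algebra_simps)
    then have ux: "u > p * x" using u by (simp add: zero_less_mult_iff)
    \<comment> \<open>With x < u / p, the negative drift x d / 2 costs at most u (2 p - 1) / (2 p),
      which leaves u / (2 p).\<close>
    have "p * x * (2 * p - 1) \<le> u * (2 * p - 1)"
      using ux p2 by (intro mult_right_mono) auto
    then have U0: "U \<ge> u / (2 * p)"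
      using assms(1) unfolding U_def d by (simp add: field_simps)
    then have Upos: "U \<ge> 0" using u assms(1) by (meson divide_nonneg_pos less_imp_le order_trans mult_pos_pos zero_less_numeral)
    \<comment> \<open>Since 1 + d = 2 q, the right side is 2 q D - d x M, and -d \<ge> 0
      here.\<close>
    have lower: "2 * q * (3/4 * M) \<le> D + d * (D - x * M)"
    proof -
      have "2 * q * (3/4 * M) \<le> 2 * q * D" using MD assms by (intro mult_left_mono) auto
      also have "\<dots> \<le> 2 * q * D + (- d) * (x * M)" using d0 M assms(4) by (simp add: mult_nonpos_nonneg)
      also have "\<dots> = D + d * (D - x * M)" unfolding d q by (simp add: algebra_simps)
      finally show ?thesis .
    qed
    have lower0: "0 \<le> 2 * q * (3/4 * M)" using M assms by simp
    have lower1: "0 \<le> D + d * (D - x * M)" using lower lower0 by (rule order_trans[rotated])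
    have MA: "(1/2 - p) * M * A \<le> 0" using p2 M A by (simp add: mult_nonpos_nonneg)
    have AA: "0 \<le> p * q * A\<^sup>2" using assms by simp
    have base: "(3/4 - p) * M\<^sup>2 \<le> Y * (D + d * (D - x * M)) * U"
    proof (cases "p \<ge> 3/4")
      case True
      then have "(3/4 - p) * M\<^sup>2 \<le> 0" by (simp add: mult_nonpos_nonneg)
      also have "0 \<le> Y * (D + d * (D - x * M)) * U"
        using Y Upos lower lower0 by simp
      finally show ?thesis .
    next
      case False
      have "p * x * u \<ge> 0" using assms u by simp
      \<comment> \<open>7/10 is a rational below sqrt (1/2), and u^2 \<ge> p \<ge> 1/2. With p < 3/4
        this yields U \<ge> 7/15, and 2 * (3/4) * (7/15) = 7/10 is enough because 3/4 - p \<le>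
        (7/10) q.\<close>
      then have "u\<^sup>2 \<ge> (7/10)\<^sup>2" using c2' p2 by (simp add: power2_eq_square)
      then have "u \<ge> 7/10" using u by (intro power2_le_imp_le[of "7/10" u]) auto
      then have "u / (2 * p) \<ge> (7/10) / (2 * (3/4))" using p2 False by (intro frac_le) auto
      then have U: "U \<ge> 7/15" using U0 by simp
      have "(3/4 - p) * M\<^sup>2 \<le> (7/10 * q) * M\<^sup>2"
        using p2 by (intro mult_right_mono) (auto simp: q)
      also have "\<dots> = M * (2 * q * (3/4 * M)) * (7/15)" by (simp add: power2_eq_square)
      also have "\<dots> \<le> Y * (D + d * (D - x * M)) * U"
        using Y M A YMA lower lower1 U assms(2) by (intro mult_mono mult_nonneg_nonneg) auto
      finally show ?thesis .
    qed
    show ?thesis using base MA AA by linarith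
  qed
  then show ?thesis by (simp add: U_def u_def)
qed

section \<open>Stirling's formula with two-sided remainder bounds\<close>

text \<open>The exponent r in n! = sqrt (2 pi n) (n / e)^n exp r.\<close>

definition stirling_rem :: "nat \<Rightarrow> real" where
  "stirling_rem n = ln (fact n) - (real n + 1/2) * ln (real n) + real n - ln (2 * pi) / 2"

text \<open>The middle term is 2 artanh z, with series 2 z + 2 z^3 / 3 + 2 z^5 / 5 + ...; the bounds
  are its first term and a geometric majorant of the rest. The proof compares derivatives.\<close>

lemma artanh_bounds:
  fixes z :: real
  assumes "0 \<le> z" "z < 1"
  shows "2 * z \<le> ln (1 + z) - ln (1 - z)"
    and "ln (1 + z) - ln (1 - z) \<le> 2 * z + 2 * z^3 / (3 * (1 - z\<^sup>2))"
proof -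
  have deriv: "((\<lambda>s. ln (1 + s) - ln (1 - s)) has_real_derivative 2 / (1 - s\<^sup>2)) (at s)"
    and pos: "0 < 1 - s\<^sup>2" if "0 \<le> s" "s \<le> z" for s :: real
  proof -
    have s: "0 < 1 + s" "0 < 1 - s" using that assms by auto
    have eq: "1 - s\<^sup>2 = (1 + s) * (1 - s)" by (simp add: power2_eq_square algebra_simps)
    show "0 < 1 - s\<^sup>2" unfolding eq using s by simp
    show "((\<lambda>s. ln (1 + s) - ln (1 - s)) has_real_derivative 2 / (1 - s\<^sup>2)) (at s)"
    proof -
      have "((\<lambda>s. ln (1 + s) - ln (1 - s)) has_real_derivative 1 / (1 + s) + 1 / (1 - s)) (at s)"
        using s by (auto intro!: derivative_eq_intros)
      moreover have "1 / (1 + s) + 1 / (1 - s) = 2 / ((1 + s) * (1 - s))"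
        using s by (simp add: add_frac_eq)
      ultimately show ?thesis by (simp only: eq)
    qed
  qed
  have "ln (1 + 0) - ln (1 - 0) - 2 * 0 \<le> ln (1 + z) - ln (1 - z) - 2 * z"
  proof (rule DERIV_nonneg_imp_nondecreasing[OF assms(1)], intro exI conjI)
    fix s :: real assume s: "0 \<le> s" "s \<le> z"
    show "((\<lambda>s. ln (1 + s) - ln (1 - s) - 2 * s) has_real_derivative 2 / (1 - s\<^sup>2) - 2) (at s)"
      by (rule DERIV_diff[OF deriv[OF s]]) (auto intro!: derivative_eq_intros)
    show "0 \<le> 2 / (1 - s\<^sup>2) - 2" using pos[OF s] by (simp add: field_simps)
  qed
  then show "2 * z \<le> ln (1 + z) - ln (1 - z)" by simp
  have "2 * 0 + 2 * 0^3 / (3 * (1 - 0\<^sup>2)) - (ln (1 + 0) - ln (1 - 0))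
      \<le> 2 * z + 2 * z^3 / (3 * (1 - z\<^sup>2)) - (ln (1 + z) - ln (1 - z))"
  proof (rule DERIV_nonneg_imp_nondecreasing[OF assms(1)], intro exI conjI)
    fix s :: real assume s: "0 \<le> s" "s \<le> z"
    have "((\<lambda>s. 2 * s + 2 * s^3 / (3 * (1 - s\<^sup>2))) has_real_derivative
       2 + (6 * s\<^sup>2 * (3 * (1 - s\<^sup>2)) - 2 * s^3 * (- 6 * s)) / ((3 * (1 - s\<^sup>2)) * (3 * (1 - s\<^sup>2)))) (at s)"
      using pos[OF s] by (auto intro!: derivative_eq_intros)
    then show "((\<lambda>s. 2 * s + 2 * s^3 / (3 * (1 - s\<^sup>2)) - (ln (1 + s) - ln (1 - s))) has_real_derivative
       2 + (6 * s\<^sup>2 * (3 * (1 - s\<^sup>2)) - 2 * s^3 * (- 6 * s)) / ((3 * (1 - s\<^sup>2)) * (3 * (1 - s\<^sup>2)))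
       - 2 / (1 - s\<^sup>2)) (at s)"
      by (intro DERIV_diff deriv s)
    have "2 + (6 * s\<^sup>2 * (3 * (1 - s\<^sup>2)) - 2 * s^3 * (- 6 * s)) / ((3 * (1 - s\<^sup>2)) * (3 * (1 - s\<^sup>2)))
       - 2 / (1 - s\<^sup>2) = 4 * s^4 / (3 * (1 - s\<^sup>2)\<^sup>2)"
      using pos[OF s] by (simp add: divide_simps) algebra
    then show "0 \<le> 2 + (6 * s\<^sup>2 * (3 * (1 - s\<^sup>2)) - 2 * s^3 * (- 6 * s)) / ((3 * (1 - s\<^sup>2)) * (3 * (1 - s\<^sup>2)))
       - 2 / (1 - s\<^sup>2)" by simp
  qed
  then show "ln (1 + z) - ln (1 - z) \<le> 2 * z + 2 * z^3 / (3 * (1 - z\<^sup>2))" by simp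
qed

text \<open>For z = 1 / (2 n + 1) one has (1 + z) / (1 - z) = (n + 1) / n, so the decrement is (n +
  1/2) 2 artanh z - 1. The term 2 z cancels the 1, and the error term becomes 1 / (12 n (n + 1)),
  which telescopes.\<close>

lemma stirling_rem_step:
  assumes "n \<ge> 1"
  shows "stirling_rem (Suc n) \<le> stirling_rem n"
    and "stirling_rem n - stirling_rem (Suc n) \<le> 1 / (12 * real n) - 1 / (12 * real (Suc n))"
proof -
  define z where "z = 1 / (2 * real n + 1)"
  have n: "real n > 0" using assms by simp
  have z: "0 \<le> z" "z < 1" using n by (auto simp: z_def)
  have e: "1 + z = 2 * (real n + 1) / (2 * real n + 1)" "1 - z = 2 * real n / (2 * real n + 1)"
    using n by (auto simp: z_def field_simps)
  have ln: "ln (1 + z) - ln (1 - z) = ln (real n + 1) - ln (real n)"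
    unfolding e using n by (simp add: ln_div ln_mult del: distrib_left_numeral)
  have "ln (fact (Suc n)) = ln (real n + 1) + ln (fact n :: real)"
    using n by (subst fact_Suc, subst ln_mult) (auto simp: add.commute)
  then have diff: "stirling_rem n - stirling_rem (Suc n) = (real n + 1/2) * (ln (real n + 1) - ln (real n)) - 1"
    by (simp add: stirling_rem_def algebra_simps del: fact_Suc)
  have z2: "(real n + 1/2) * (2 * z) = 1" using n by (simp add: z_def field_simps)
  have "(real n + 1/2) * (2 * z) \<le> (real n + 1/2) * (ln (real n + 1) - ln (real n))"
    using artanh_bounds(1)[OF z] n unfolding ln by (intro mult_left_mono) auto
  then show "stirling_rem (Suc n) \<le> stirling_rem n" using diff z2 by simp
  have "(real n + 1/2) * (ln (real n + 1) - ln (real n)) \<le> (real n + 1/2) * (2 * z + 2 * z^3 / (3 * (1 - z\<^sup>2)))"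
    using artanh_bounds(2)[OF z] n unfolding ln by (intro mult_left_mono) auto
  also have "\<dots> = (real n + 1/2) * (2 * z) * (1 + z\<^sup>2 / (3 * (1 - z\<^sup>2)))"
    by (simp add: algebra_simps power2_eq_square power3_eq_cube)
  also have "\<dots> = 1 + z\<^sup>2 / (3 * (1 - z\<^sup>2))" unfolding z2 by simp
  also have "1 - z\<^sup>2 = 4 * real n * (real n + 1) * z\<^sup>2"
  proof -
    have "(2 * real n + 1) * z = 1" using n by (simp add: z_def)
    then show ?thesis by algebra
  qed
  also have "z\<^sup>2 / (3 * (4 * real n * (real n + 1) * z\<^sup>2)) = 1 / (12 * (real n * (real n + 1)))"
    using n by (simp add: z_def)
  also have "\<dots> = 1 / (12 * real n) - 1 / (12 * real (Suc n))"
    using n by (simp add: field_simps)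
  finally show "stirling_rem n - stirling_rem (Suc n) \<le> 1 / (12 * real n) - 1 / (12 * real (Suc n))"
    using diff by simp
qed

text \<open>In this form the logarithm of the product can be written with the Stirling remainders at
  n and 2 n.\<close>

lemma wallis_product_eq:
  "(\<Prod>k=1..n. (4*real k^2) / (4*real k^2 - 1)) = 16 ^ n * fact n ^ 4 / ((fact (2 * n))\<^sup>2 * (2 * real n + 1))"
proof (induction n)
  case (Suc n)
  have f: "fact (2 * Suc n) = (2 * real n + 2) * (2 * real n + 1) * fact (2 * n)"
    by (simp add: algebra_simps)
  have d: "4 * (real (Suc n))\<^sup>2 - 1 = (2 * real n + 1) * (2 * real n + 3)"
    by (simp add: algebra_simps power2_eq_square)
  have "(\<Prod>k=1..Suc n. (4*real k^2) / (4*real k^2 - 1)) =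
    16 ^ n * fact n ^ 4 / ((fact (2 * n))\<^sup>2 * (2 * real n + 1)) * (4 * (real (Suc n))\<^sup>2 / ((2 * real n + 1) * (2 * real n + 3)))"
    using Suc by (simp add: d del: of_nat_Suc)
  also have "\<dots> = 16 ^ Suc n * fact (Suc n) ^ 4 / ((fact (2 * Suc n))\<^sup>2 * (2 * real (Suc n) + 1))"
    unfolding f by (simp add: divide_simps power_mult_distrib) (simp add: algebra_simps power2_eq_square eval_nat_numeral)
  finally show ?case .
qed simp

lemma stirling_rem_antimono: "m \<le> n \<Longrightarrow> 1 \<le> m \<Longrightarrow> stirling_rem n \<le> stirling_rem m"
proof (induction n rule: dec_induct)
  case (step n)
  then show ?case using stirling_rem_step(1)[of n] by simp
qed simp

lemma stirling_rem_mono_corrected: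
  "m \<le> n \<Longrightarrow> 1 \<le> m \<Longrightarrow> stirling_rem m - 1 / (12 * real m) \<le> stirling_rem n - 1 / (12 * real n)"
proof (induction n rule: dec_induct)
  case (step n)
  then show ?case using stirling_rem_step(2)[of n] by simp
qed simp

text \<open>Monotonicity and boundedness give some limit c. Wallis' product then forces ln (pi / 2)
  = 2 c + ln pi + ln (1/2), that is c = 0.\<close>

lemma tendsto_stirling_rem: "stirling_rem \<longlonglongrightarrow> 0"
proof -
  have "convergent (\<lambda>n. stirling_rem (Suc n))"
  proof (rule Bseq_monoseq_convergent)
    show "Bseq (\<lambda>n. stirling_rem (Suc n))"
    proof (rule BseqI')
      fix n
      have "stirling_rem 1 - 1 / (12 * real 1) \<le> stirling_rem (Suc n) - 1 / (12 * real (Suc n))"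
        by (rule stirling_rem_mono_corrected) auto
      moreover have "0 \<le> 1 / (12 * real (Suc n))" by simp
      moreover have "stirling_rem (Suc n) \<le> stirling_rem 1" by (rule stirling_rem_antimono) auto
      ultimately show "norm (stirling_rem (Suc n)) \<le> \<bar>stirling_rem 1\<bar> + 1/12"
        unfolding real_norm_def by linarith
    qed
    show "monoseq (\<lambda>n. stirling_rem (Suc n))"
      by (rule decseq_imp_monoseq) (auto simp: decseq_def intro: stirling_rem_antimono)
  qed
  then obtain c where c: "stirling_rem \<longlonglongrightarrow> c"
    using convergent_Suc_iff[of stirling_rem] by (auto simp: convergent_def)
  have sub: "(\<lambda>n. stirling_rem (2 * n)) \<longlonglongrightarrow> c"
    using LIMSEQ_subseq_LIMSEQ[OF c, of "\<lambda>n. 2 * n"] by (simp add: strict_mono_def o_def)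
  have ev: "\<forall>\<^sub>F n in sequentially. ln (\<Prod>k=1..n. (4*real k^2) / (4*real k^2 - 1)) =
     4 * stirling_rem n - 2 * stirling_rem (2 * n) + ln pi + ln (real n / (2 * real n + 1))"
    using eventually_gt_at_top[of 0]
  proof eventually_elim
    case (elim n)
    have "ln (\<Prod>k=1..n. (4*real k^2) / (4*real k^2 - 1)) =
       real n * ln 16 + 4 * ln (fact n) - 2 * ln (fact (2 * n)) - ln (2 * real n + 1)"
      unfolding wallis_product_eq by (simp add: ln_div ln_mult ln_realpow)
    also have "ln (16::real) = 4 * ln 2" using ln_realpow[of "2::real" 4] by simp
    finally show ?case using elim
      by (simp add: stirling_rem_def ln_mult ln_div field_simps)
  qed
  have half: "(\<lambda>n. real n / (2 * real n + 1)) \<longlonglongrightarrow> 1 / 2" by real_asymp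
  have "(\<lambda>n. 4 * stirling_rem n - 2 * stirling_rem (2 * n) + ln pi + ln (real n / (2 * real n + 1)))
      \<longlonglongrightarrow> 4 * c - 2 * c + ln pi + ln (1 / 2)"
    by (intro tendsto_add tendsto_diff tendsto_mult tendsto_const c sub tendsto_ln half) simp
  moreover have "(\<lambda>n. ln (\<Prod>k=1..n. (4*real k^2) / (4*real k^2 - 1))) \<longlonglongrightarrow> ln (pi / 2)"
    by (intro tendsto_ln wallis) simp
  ultimately have "ln (pi / 2) = 4 * c - 2 * c + ln pi + ln (1 / 2)"
    using LIMSEQ_unique tendsto_cong[OF ev] by blast
  then have "c = 0" by (simp add: ln_div)
  then show ?thesis using c by simp
qed

lemma stirling_rem_nonneg: assumes "n \<ge> 1" shows "0 \<le> stirling_rem n"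
proof (rule tendsto_upperbound[OF tendsto_stirling_rem])
  show "\<forall>\<^sub>F m in sequentially. stirling_rem m \<le> stirling_rem n"
    using eventually_ge_at_top[of n] by eventually_elim (rule stirling_rem_antimono[OF _ assms])
qed simp

lemma stirling_rem_le: assumes "n \<ge> 1" shows "stirling_rem n \<le> 1 / (12 * real n)"
proof -
  have "(\<lambda>m. stirling_rem m - 1 / (12 * real m)) \<longlonglongrightarrow> 0 - 0"
    by (intro tendsto_diff tendsto_stirling_rem) real_asymp
  then have "stirling_rem n - 1 / (12 * real n) \<le> 0 - 0"
  proof (rule tendsto_lowerbound)
    show "\<forall>\<^sub>F m in sequentially. stirling_rem n - 1 / (12 * real n) \<le> stirling_rem m - 1 / (12 * real m)"
      using eventually_ge_at_top[of n] by eventually_elim (rule stirling_rem_mono_corrected[OF _ assms])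
  qed simp
  then show ?thesis by simp
qed

text \<open>At success probability k / n the powers cancel the main Stirling terms of the three
  factorials, leaving the square-root factor and the remainders.\<close>

lemma ln_binomial_peak:
  assumes "1 \<le> k" "k < n"
  defines "t \<equiv> real k / real n"
  shows "ln (real (n choose k) * t ^ k * (1 - t) ^ (n - k)) =
     stirling_rem n - stirling_rem k - stirling_rem (n - k) - ln (2 * pi * real n * t * (1 - t)) / 2"
proof -
  define m where "m = n - k"
  have n: "real n > 0" "real k > 0" "real m > 0" using assms by (auto simp: m_def)
  have t1: "1 - t = real m / real n" using n assms by (simp add: t_def m_def field_simps)
  have t0: "t > 0" "1 - t > 0" using n unfolding t1 by (auto simp: t_def)
  have lt: "ln t = ln (real k) - ln (real n)" "ln (1 - t) = ln (real m) - ln (real n)"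
    unfolding t1 using n by (auto simp: t_def ln_div)
  have b: "real (n choose k) = fact n / (fact k * fact m)"
    using assms by (simp add: binomial_fact m_def)
  have "ln (real (n choose k) * t ^ k * (1 - t) ^ m) = ln (fact n) - ln (fact k) - ln (fact m)
     + real k * (ln (real k) - ln (real n)) + real m * (ln (real m) - ln (real n))"
    unfolding b using n t0 lt by (simp add: ln_mult ln_div ln_realpow)
  moreover have "ln (2 * pi * real n * t * (1 - t)) = ln (2 * pi) + ln (real k) + ln (real m) - ln (real n)"
    using n t0 lt by (simp add: ln_mult ln_div)
  moreover have "real n = real k + real m" using assms by (simp add: m_def)
  ultimately show ?thesis
    unfolding stirling_rem_def m_def[symmetric] by (simp add: algebra_simps add_divide_distrib diff_divide_distrib)
qed

lemma stirling_rem_binomial_bounds: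
  assumes "1 \<le> k" "k < n"
  defines "t \<equiv> real k / real n"
  shows "0 \<le> stirling_rem k + stirling_rem (n - k) - stirling_rem n"
    and "stirling_rem k + stirling_rem (n - k) - stirling_rem n \<le> 1 / (12 * real n * t * (1 - t))"
proof -
  show "0 \<le> stirling_rem k + stirling_rem (n - k) - stirling_rem n"
    using stirling_rem_antimono[of k n] stirling_rem_nonneg[of "n - k"] assms by force
  define m where "m = n - k"
  have n: "real n > 0" "real k > 0" "real m > 0" using assms by (auto simp: m_def)
  have "1 - t = real m / real n" using n assms by (simp add: t_def m_def field_simps)
  then have "1 / (12 * real n * t * (1 - t)) = real n / (12 * real k * real m)"
    using n by (simp add: t_def)
  also have "\<dots> = (real k + real m) / (12 * real k * real m)" using assms by (simp add: m_def)
  \<comment> \<open>The target is thus the sum of the remainder bounds for k and n - k.\<close>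
  also have "\<dots> = 1 / (12 * real k) + 1 / (12 * real m)"
    using n by (simp add: field_simps)
  finally have "1 / (12 * real n * t * (1 - t)) = 1 / (12 * real k) + 1 / (12 * real m)" .
  moreover have "stirling_rem k \<le> 1 / (12 * real k)" "stirling_rem m \<le> 1 / (12 * real m)" "0 \<le> stirling_rem n"
    using n assms by (auto intro!: stirling_rem_le stirling_rem_nonneg)
  ultimately show "stirling_rem k + stirling_rem (n - k) - stirling_rem n \<le> 1 / (12 * real n * t * (1 - t))"
    unfolding m_def[symmetric] by linarith
qed

section \<open>Calculus tools and the derivative of the binomial tail\<close>

lemma has_real_derivative_mills_A:
  "(mills_A has_real_derivative mills_D x - x * mills_M x) (at x)"
proof -
  have "((\<lambda>x. x * (1 - x * Yfun x)) has_real_derivative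
     1 * (1 - x * Yfun x) + x * (0 - (1 * Yfun x + x * (x * Yfun x - 1)))) (at x)"
    by (auto intro!: derivative_eq_intros has_real_derivative_Yfun)
  moreover have "1 * (1 - x * Yfun x) + x * (0 - (1 * Yfun x + x * (x * Yfun x - 1))) = mills_D x - x * mills_M x"
    by (simp add: mills_D_def mills_M_def mills_A_def algebra_simps)
  ultimately show ?thesis by (simp add: mills_A_def[abs_def] mills_D_def[abs_def])
qed

text \<open>The derivative of Y + A is -x M, so the maximum is at 0. Half of it is the constant sqrt
  (pi / 8) in \<open>lE\<close>.\<close>

lemma Yfun_plus_mills_A_le:
  assumes "x \<ge> 0" shows "Yfun x + mills_A x \<le> sqrt (pi / 2)"
proof -
  have "Yfun x + mills_A x \<le> Yfun 0 + mills_A 0"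
  proof (rule DERIV_nonpos_imp_nonincreasing[OF assms], intro exI conjI)
    fix s :: real assume s: "0 \<le> s" "s \<le> x"
    show "((\<lambda>x. Yfun x + mills_A x) has_real_derivative (s * Yfun s - 1) + (mills_D s - s * mills_M s)) (at s)"
      by (intro DERIV_add has_real_derivative_Yfun has_real_derivative_mills_A)
    show "(s * Yfun s - 1) + (mills_D s - s * mills_M s) \<le> 0"
      using s mills_M_nonneg[of s] by (simp add: mills_D_def)
  qed
  then show ?thesis by (simp add: Yfun_0 mills_A_def)
qed

text \<open>The left endpoint enters only through a limit, because \<open>x\<close> and
  \<open>e\<close> divide by \<open>s\<close>, which vanishes at p = 0.\<close>

lemma nonneg_of_deriv_nonneg:
  fixes f f' :: "real \<Rightarrow> real"
  assumes "0 < a" and "\<And>p. 0 < p \<Longrightarrow> p \<le> a \<Longrightarrow> (f has_real_derivative f' p) (at p)"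
    and "\<And>p. 0 < p \<Longrightarrow> p \<le> a \<Longrightarrow> 0 \<le> f' p" and "(f \<longlongrightarrow> 0) (at_right 0)"
  shows "0 \<le> f a"
proof (rule tendsto_upperbound[OF assms(4)])
  have "\<forall>\<^sub>F p in at_right 0. p \<in> {0<..<a}"
    using assms(1) by (rule eventually_at_right_real)
  then show "\<forall>\<^sub>F p in at_right 0. f p \<le> f a"
  proof eventually_elim
    case (elim p)
    then have "p \<le> a" by simp
    then show ?case
    proof (rule DERIV_nonneg_imp_nondecreasing, intro exI conjI)
      fix z assume "p \<le> z" "z \<le> a"
      then show "(f has_real_derivative f' z) (at z)" "0 \<le> f' z" using elim by (auto intro: assms(2,3))
    qed
  qed
qed simp

lemma exp_quadratic_ge_1:
  fixes e :: real assumes "e \<ge> 0" shows "1 \<le> exp e * (1 - e + e\<^sup>2 / 2)"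
proof -
  have "exp 0 * (1 - 0 + 0\<^sup>2 / 2) \<le> exp e * (1 - e + e\<^sup>2 / 2)"
  proof (rule DERIV_nonneg_imp_nondecreasing[OF assms], intro exI conjI)
    fix s :: real
    show "((\<lambda>e. exp e * (1 - e + e\<^sup>2 / 2)) has_real_derivative exp s * (s\<^sup>2 / 2)) (at s)"
      by (auto intro!: derivative_eq_intros simp: algebra_simps)
  qed simp
  then show ?thesis by simp
qed

text \<open>Each summand differentiates to n times a difference of consecutive point probabilities
  \<open>g\<close> for n - 1 trials, so the sum telescopes.\<close>

lemma has_real_derivative_P_X:
  assumes "1 \<le> k" "k \<le> n"
  shows "(P_X n k has_real_derivative
     real n * (real ((n - 1) choose (k - 1)) * p ^ (k - 1) * (1 - p) ^ (n - k))) (at p)"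
proof -
  obtain N where N: "n = Suc N" using assms by (cases n) auto
  define g where "g j = real (N choose (j - 1)) * p ^ (j - 1) * (1 - p) ^ (n - j)" for j
  have summand: "((\<lambda>p. real (n choose j) * p ^ j * (1 - p) ^ (n - j)) has_real_derivative
      real n * (g j - g (Suc j))) (at p)" if j: "j \<in> {k..n}" for j
  proof -
    obtain i where i: "j = Suc i" using j assms(1) by (cases j) auto
    have iN: "i \<le> N" using j i N by simp
    have a1: "real (Suc N choose Suc i) * real (Suc i) = real (Suc N) * real (N choose i)"
      by (metis Suc_times_binomial_eq of_nat_mult mult.commute)
    have a2: "real (Suc N choose Suc i) * real (N - i) = real (Suc N) * real (N choose Suc i)"
      using binomial_absorb_comp[of "Suc N" "Suc i"]
      by (metis diff_Suc_1 diff_Suc_Suc mult.commute of_nat_mult)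
    \<comment> \<open>For j = n the exponent N - i - 1 truncates to 0, but its coefficient N - i is
      0 as well.\<close>
    have "((\<lambda>p. real (n choose j) * p ^ j * (1 - p) ^ (n - j)) has_real_derivative
       (real (Suc N choose Suc i) * real (Suc i)) * p ^ i * (1 - p) ^ (N - i)
       - (real (Suc N choose Suc i) * real (N - i)) * p ^ Suc i * (1 - p) ^ (N - i - 1)) (at p)"
      unfolding N i
      by (auto intro!: derivative_eq_intros simp: algebra_simps simp del: power_Suc of_nat_Suc binomial_Suc_Suc)
    then show ?thesis
      unfolding a1 a2 by (simp add: g_def N i algebra_simps)
  qed
  have "((\<lambda>p. \<Sum>j\<in>{k..n}. real (n choose j) * p ^ j * (1 - p) ^ (n - j)) has_real_derivative
      (\<Sum>j\<in>{k..n}. real n * (g j - g (Suc j)))) (at p)"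
    by (rule DERIV_sum) (rule summand)
  also have "(\<Sum>j\<in>{k..n}. real n * (g j - g (Suc j))) = real n * (\<Sum>j\<in>{k..n}. g j - g (Suc j))"
    by (simp add: sum_distrib_left)
  also have "(\<Sum>j\<in>{k..n}. g j - g (Suc j)) = g k - g (Suc n)"
    using assms(2) sum_Suc_diff[of k n "\<lambda>j. - g j"] by simp
  also have "g (Suc n) = 0" by (simp add: g_def N)
  finally show ?thesis by (simp add: g_def N P_X_def[abs_def])
qed

section \<open>The main term and the tail as functions of p\<close>

locale binomial_upper_tail =
  fixes n k :: nat
  assumes k1: "1 \<le> k" and kn: "k < n"
begin

definition s where "s p = sqrt (real n * p * (1 - p))"
definition x where "x p = (real k - real n * p) / s p"
definition b where "b p = real ((n - 1) choose (k - 1)) * p ^ (k - 1) * (1 - p) ^ (n - k)" for p :: real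
definition F where "F p = s p * b p * Yfun (x p)"
definition E where "E p = (Yfun (x p) - (1 - 2 * p) * mills_A (x p)) / 2"
definition e where "e p = E p / s p"

context
  fixes p :: real
  assumes p0: "0 < p" and pt: "p < real k / real n"
begin

lemma npos: "real n > 0" using kn by simp

lemma np_less: "real n * p < real k" using pt npos by (simp add: field_simps)

lemma p1: "p < 1"
proof -
  have "real k / real n < 1" using kn by simp
  then show ?thesis using pt by simp
qed

lemma s_pos: "0 < s p" using npos p0 p1 by (simp add: s_def)

lemma s_sq: "(s p)\<^sup>2 = real n * p * (1 - p)" using npos p0 p1 by (simp add: s_def)

text \<open>Eliminating n in favour of \<open>s\<close> turns the derivative computations into
  rational identities.\<close>

lemma n_eq: "real n = (s p)\<^sup>2 / (p * (1 - p))" using p0 p1 by (simp add: s_sq)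

lemma xs: "x p * s p = real k - real n * p" using s_pos by (simp add: x_def)

lemma x_pos: "0 < x p" using np_less s_pos by (simp add: x_def)

lemma b_pos: "0 < b p"
proof -
  have "0 < (n - 1) choose (k - 1)" using k1 kn by simp
  then show ?thesis using p0 p1 by (simp add: b_def)
qed

lemma F_pos: "0 < F p" using s_pos b_pos Yfun_pos by (simp add: F_def)

lemma has_real_derivative_s: "(s has_real_derivative s p * (1 - 2 * p) / (2 * (p * (1 - p)))) (at p)"
proof -
  have "0 < real n * p * (1 - p)" using npos p0 p1 by simp
  then have "((\<lambda>p. sqrt (real n * p * (1 - p))) has_real_derivative
     inverse (sqrt (real n * p * (1 - p))) / 2 * (real n * (1 - 2 * p))) (at p)"
    by (auto intro!: derivative_eq_intros simp: algebra_simps)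
  then have "(s has_real_derivative inverse (s p) / 2 * (real n * (1 - 2 * p))) (at p)"
    by (simp add: s_def[abs_def])
  moreover have "inverse (s p) / 2 * (real n * (1 - 2 * p)) = s p * (1 - 2 * p) / (2 * (p * (1 - p)))"
    using s_pos p0 p1 unfolding n_eq by (simp add: field_simps power2_eq_square)
  ultimately show ?thesis by (simp only:)
qed

lemma has_real_derivative_x:
  "(x has_real_derivative - (s p + x p * (1 - 2 * p) / 2) / (p * (1 - p))) (at p)"
proof -
  have "((\<lambda>p. (real k - real n * p) / s p) has_real_derivative
     ((0 - real n * 1) * s p - (real k - real n * p) * (s p * (1 - 2 * p) / (2 * (p * (1 - p))))) / (s p * s p)) (at p)"
    using s_pos by (auto intro!: derivative_eq_intros has_real_derivative_s)
  moreover have "((0 - real n * 1) * s p - (real k - real n * p) * (s p * (1 - 2 * p) / (2 * (p * (1 - p))))) / (s p * s p)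
     = - (s p + x p * (1 - 2 * p) / 2) / (p * (1 - p))"
    unfolding xs[symmetric] using s_pos p0 p1 unfolding n_eq
    by (simp add: divide_simps) (simp add: algebra_simps power2_eq_square)
  ultimately show ?thesis by (simp add: x_def[abs_def])
qed

lemma has_real_derivative_b:
  "(b has_real_derivative b p * (x p * s p - (1 - p)) / (p * (1 - p))) (at p)"
proof -
  define m where "m = n - k"
  have m: "m \<ge> 1" "real n = real k + real m" using kn by (auto simp: m_def)
  define K where "K = k - 1"
  have K: "real k = real K + 1" using k1 by (simp add: K_def of_nat_diff)
  \<comment> \<open>The factor j covers j = 0, where j - 1 truncates; this occurs as K = 0 when k =
    1.\<close>
  have pw: "real j * z ^ (j - 1) = real j * z ^ j / z" if "z \<noteq> 0" for j and z :: real
    using that by (cases j) auto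
  have "(b has_real_derivative real ((n - 1) choose K) *
     (real K * p ^ (K - 1) * (1 - p) ^ m - p ^ K * (real m * (1 - p) ^ (m - 1)))) (at p)"
    unfolding b_def[abs_def] m_def[symmetric] K_def[symmetric] by (auto intro!: derivative_eq_intros simp: algebra_simps)
  moreover have "real ((n - 1) choose K) *
     (real K * p ^ (K - 1) * (1 - p) ^ m - p ^ K * (real m * (1 - p) ^ (m - 1)))
      = real ((n - 1) choose K) * p ^ K * (1 - p) ^ m * (real K / p - real m / (1 - p))"
  proof -
    have "real K * p ^ (K - 1) = real K * p ^ K / p" "real m * (1 - p) ^ (m - 1) = real m * (1 - p) ^ m / (1 - p)"
      using p0 p1 by (intro pw; simp)+
    then show ?thesis by (simp only:) (simp add: left_diff_distrib right_diff_distrib mult_ac)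
  qed
  moreover have "real K / p - real m / (1 - p) = (x p * s p - (1 - p)) / (p * (1 - p))"
    unfolding xs m(2) using p0 p1 by (simp add: field_simps K)
  ultimately show ?thesis unfolding b_def[of p] m_def[symmetric] K_def[symmetric] by simp
qed

lemma has_real_derivative_Yx:
  "((\<lambda>p. Yfun (x p)) has_real_derivative mills_D (x p) * (s p + x p * (1 - 2 * p) / 2) / (p * (1 - p))) (at p)"
proof -
  have "(a - 1) * (- u / w) = (1 - a) * u / w" for a u w :: real
    by (simp add: divide_inverse left_diff_distrib)
  then show ?thesis
    using DERIV_chain2[OF has_real_derivative_Yfun has_real_derivative_x]
    unfolding mills_D_def by metis
qed

lemma has_real_derivative_F: "(F has_real_derivative real n * b p * (1 - e p)) (at p)"
proof -
  define w where "w = 1 / (p * (1 - p))"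
  let ?d = "1 - 2 * p"
  have "(F has_real_derivative
      (s p * ?d / (2 * (p * (1 - p))) * b p + b p * (x p * s p - (1 - p)) / (p * (1 - p)) * s p) * Yfun (x p)
      + mills_D (x p) * (s p + x p * ?d / 2) / (p * (1 - p)) * (s p * b p)) (at p)"
    unfolding F_def[abs_def]
    by (intro DERIV_mult has_real_derivative_s has_real_derivative_b has_real_derivative_Yx)
  moreover have "(S * d / (2 * c) * B + B * R / c * S) * Y + D * U / c * (S * B)
      = S * B * (1 / c) * (Y * (d / 2 + R) + D * U)" for S d c B R Y D U :: real
    by (cases "c = 0") (auto simp: field_simps)
  note this[of "s p" ?d "p * (1 - p)" "b p" "x p * s p - (1 - p)" "Yfun (x p)" "mills_D (x p)" "s p + x p * ?d / 2"]
  moreover have "real n * b p * (1 - e p) = s p * b p * w * (s p - E p)"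
  proof -
    have "S\<^sup>2 / c * B * (1 - G / S) = S * B * (1 / c) * (S - G)" if "S \<noteq> 0" for S c B G :: real
      using that by (cases "c = 0") (auto simp: field_simps power2_eq_square)
    then show ?thesis
      unfolding n_eq w_def e_def using s_pos by (metis less_irrefl)
  qed
  \<comment> \<open>The large terms x s Y, from b', and s D, from Y', add up to s because D = 1 - x
    Y; what remains is -E.\<close>
  moreover have "Yfun (x p) * (?d / 2 + (x p * s p - (1 - p))) + mills_D (x p) * (s p + x p * ?d / 2) = s p - E p"
  proof -
    have "Y * ((1 - 2 * p) / 2 + (X * S - (1 - p))) + (1 - X * Y) * (S + X * (1 - 2 * p) / 2)
        = S - (Y - (1 - 2 * p) * (X * (1 - X * Y))) / 2" for Y X S :: real
      by (simp add: field_simps)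
    then show ?thesis unfolding E_def mills_A_def mills_D_def .
  qed
  ultimately show ?thesis by (simp only: w_def)
qed

text \<open>The quotient-rule derivative of E / s, grouped so that the product in
  \<open>core_inequality\<close> appears.\<close>

definition e' where "e' = ((mills_D (x p) + (1 - 2 * p) * (mills_D (x p) - x p * mills_M (x p)))
    * (s p + x p * (1 - 2 * p) / 2) / 2 + p * (1 - p) * mills_A (x p) - E p * (1 - 2 * p) / 2) / (p * (1 - p)) / s p"

lemma has_real_derivative_e: "(e has_real_derivative e') (at p)"
proof -
  let ?x' = "- (s p + x p * (1 - 2 * p) / 2) / (p * (1 - p))"
  let ?E' = "(mills_D (x p) * (s p + x p * (1 - 2 * p) / 2) / (p * (1 - p))
    - ((- 2) * mills_A (x p) + ((mills_D (x p) - x p * mills_M (x p)) * ?x') * (1 - 2 * p))) / 2"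
  have "((\<lambda>p. 1 - 2 * p) has_real_derivative - 2) (at p)"
    by (auto intro!: derivative_eq_intros)
  then have "(E has_real_derivative ?E') (at p)"
    unfolding E_def[abs_def]
    by (intro DERIV_cdivide DERIV_diff DERIV_mult has_real_derivative_Yx
        DERIV_chain2[OF has_real_derivative_mills_A has_real_derivative_x])
  then have "(e has_real_derivative (?E' * s p - E p * (s p * (1 - 2 * p) / (2 * (p * (1 - p))))) / (s p * s p)) (at p)"
    unfolding e_def[abs_def] using s_pos by (intro DERIV_divide has_real_derivative_s) auto
  moreover have "(?E' * s p - E p * (s p * (1 - 2 * p) / (2 * (p * (1 - p))))) / (s p * s p) = e'"
    using s_pos p0 p1 unfolding e'_def by (simp add: divide_simps) (simp add: algebra_simps)
  ultimately show ?thesis by simp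
qed

text \<open>Eliminating n and multiplying by p (1 - p) gives E^2 / 2 \<le> Y (W / 2 + p (1 - p) A -
  E (1 - 2 p) / 2). Substituting Y = M + A in the terms with E and A turns this into
  \<open>core_inequality\<close>.\<close>

lemma e'_bound: "real n * ((e p)\<^sup>2 / 2) \<le> s p * Yfun (x p) * e'"
proof -
  let ?Y = "Yfun (x p)" and ?D = "mills_D (x p)" and ?A = "mills_A (x p)" and ?M = "mills_M (x p)"
  define y where "y = 1 / s p"
  define W where "W = (?D + (1 - 2 * p) * (?D - x p * ?M)) * (s p + x p * (1 - 2 * p) / 2)"
  have y: "y > 0" using s_pos by (simp add: y_def)
  have "y\<^sup>2 - x p * y = (1 - x p * s p) / (s p)\<^sup>2" "y\<^sup>2 + x p * y = (1 + x p * s p) / (s p)\<^sup>2"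
    using s_pos by (simp_all add: y_def field_simps power2_eq_square)
  then have "(1 - p) * (y\<^sup>2 - x p * y) = (1 - real k + real n * p) / (real n * p)"
    and "p * (y\<^sup>2 + x p * y) = (1 + real k - real n * p) / (real n * (1 - p))"
    unfolding xs s_sq using p0 p1 npos by simp_all
  \<comment> \<open>These are exactly k \<ge> 1 and k + 1 \<le> n.\<close>
  then have "(1 - p) * (y\<^sup>2 - x p * y) \<le> 1" "p * (y\<^sup>2 + x p * y) \<le> 1"
    using p0 p1 npos k1 kn by (auto simp: divide_le_eq algebra_simps)
  then have "(3/4 - p) * ?M\<^sup>2 + (1/2 - p) * ?M * ?A - p * (1 - p) * ?A\<^sup>2
      \<le> ?Y * (?D + ((1 - p) - p) * (?D - x p * ?M)) * (1 / y + x p * ((1 - p) - p) / 2)"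
    using p0 p1 x_pos y by (intro core_inequality) auto
  then have core: "(3/4 - p) * ?M\<^sup>2 + (1/2 - p) * ?M * ?A - p * (1 - p) * ?A\<^sup>2 \<le> ?Y * W"
    by (simp add: W_def y_def algebra_simps)
  have Y: "?Y = ?M + ?A" by (simp add: mills_M_def)
  have "(E p)\<^sup>2 + (1 - 2 * p) * ?Y * E p - 2 * p * (1 - p) * ?Y * ?A
      = (3/4 - p) * ?M\<^sup>2 + (1/2 - p) * ?M * ?A - p * (1 - p) * ?A\<^sup>2"
    unfolding E_def Y by (simp add: field_simps power2_eq_square)
  with core have "(E p)\<^sup>2 / 2 \<le> ?Y * (W / 2 + p * (1 - p) * ?A - E p * (1 - 2 * p) / 2)"
    by (simp add: field_simps)
  then have "(E p)\<^sup>2 / 2 / (p * (1 - p)) \<le> ?Y * (W / 2 + p * (1 - p) * ?A - E p * (1 - 2 * p) / 2) / (p * (1 - p))"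
    using p0 p1 by (intro divide_right_mono) auto
  moreover have "real n * ((e p)\<^sup>2 / 2) = (E p)\<^sup>2 / 2 / (p * (1 - p))"
    using s_pos unfolding n_eq e_def by (simp add: power_divide)
  moreover have "s p * ?Y * e' = ?Y * (W / 2 + p * (1 - p) * ?A - E p * (1 - 2 * p) / 2) / (p * (1 - p))"
    using s_pos unfolding e'_def W_def[symmetric] by simp
  ultimately show ?thesis by (simp only:)
qed

text \<open>As |1 - 2 p| < 1 and 0 \<le> A \<le> Y, E lies between 0 and (Y + A) / 2, hence below
  Y.\<close>

lemma E_bounds: "0 \<le> E p" "E p \<le> sqrt (pi / 8)" "E p \<le> 1 / x p"
proof -
  let ?Y = "Yfun (x p)" and ?A = "mills_A (x p)"
  have x: "x p \<ge> 0" using x_pos by simp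
  have A: "0 \<le> ?A" "?A \<le> ?Y"
    using mills_A_nonneg[OF x] mills_M_nonneg[OF x] by (auto simp: mills_M_def)
  define z where "z = (1 - 2 * p) * ?A"
  have z: "z \<le> 1 * ?A" "(-1) * ?A \<le> z"
    unfolding z_def using A p0 p1 by (intro mult_right_mono; simp)+
  have Ez: "E p = (?Y - z) / 2" unfolding E_def z_def ..
  have E: "0 \<le> E p" "E p \<le> (?Y + ?A) / 2" "E p \<le> ?Y" unfolding Ez using A z by simp_all
  show "0 \<le> E p" by (fact E(1))
  have "sqrt (pi / 2) / 2 = sqrt (pi / 8)"
  proof -
    have "pi / 8 = pi / 2 / 4" by simp
    then show ?thesis by (simp only: real_sqrt_divide[of "pi / 2" 4] real_sqrt_four)
  qed
  then show "E p \<le> sqrt (pi / 8)" using E(2) Yfun_plus_mills_A_le[OF x] by simp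
  show "E p \<le> 1 / x p" using E(3) Yfun_upper[OF x_pos] by simp
qed

lemma e_nonneg: "0 \<le> e p" using E_bounds(1) s_pos by (simp add: e_def)

lemma e_le: "e p \<le> 1 / (real k - real n * p)"
  using E_bounds(3) s_pos x_pos unfolding xs[symmetric] by (simp add: e_def field_simps)

text \<open>Y \<le> 1 / x removes \<open>s\<close> and \<open>Yfun\<close>; the majorant is
  continuous at p = 0 and vanishes there through its factor p.\<close>

lemma F_exp_e_le:
  "F p * exp (e p) \<le> real n * p * (1 - p) * b p / (real k - real n * p) * exp (1 / (real k - real n * p))"
proof (rule mult_mono)
  have "F p \<le> s p * b p * (1 / x p)"
    unfolding F_def using s_pos b_pos Yfun_upper[OF x_pos] by (intro mult_left_mono) auto
  also have "\<dots> = (s p)\<^sup>2 * b p / (x p * s p)" using s_pos x_pos by (simp add: field_simps power2_eq_square)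
  finally show "F p \<le> real n * p * (1 - p) * b p / (real k - real n * p)" unfolding xs s_sq .
  show "exp (e p) \<le> exp (1 / (real k - real n * p))" using e_le by simp
  show "0 \<le> real n * p * (1 - p) * b p / (real k - real n * p)"
    using npos p0 p1 b_pos np_less by simp
qed simp

end

lemma eventually_valid: "\<forall>\<^sub>F p in at_right 0. p \<in> {0<..<real k / real n}"
  using k1 kn by (intro eventually_at_right_real) simp

lemma tendsto_F_exp_e: "((\<lambda>p. F p * exp (e p)) \<longlongrightarrow> 0) (at_right 0)"
proof (rule tendsto_sandwich)
  let ?B = "\<lambda>p. real n * p * (1 - p) * b p / (real k - real n * p) * exp (1 / (real k - real n * p))"
  show "\<forall>\<^sub>F p in at_right 0. 0 \<le> F p * exp (e p)"
    using eventually_valid by eventually_elim (simp add: F_pos less_imp_le)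
  show "\<forall>\<^sub>F p in at_right 0. F p * exp (e p) \<le> ?B p"
    using eventually_valid by eventually_elim (rule F_exp_e_le, auto)
  \<comment> \<open>The denominators equal k at p = 0, and k \<ge> 1.\<close>
  have "isCont ?B 0"
    unfolding b_def[abs_def] using k1 by (intro continuous_intros) auto
  then have "(?B \<longlongrightarrow> ?B 0) (at 0)" by (rule isContD)
  then show "(?B \<longlongrightarrow> 0) (at_right 0)" by (simp add: filterlim_at_split)
qed simp

lemma tendsto_F: "(F \<longlongrightarrow> 0) (at_right 0)"
proof (rule tendsto_sandwich[OF _ _ tendsto_const tendsto_F_exp_e])
  show "\<forall>\<^sub>F p in at_right 0. 0 \<le> F p"
    using eventually_valid by eventually_elim (simp add: F_pos less_imp_le)
  show "\<forall>\<^sub>F p in at_right 0. F p \<le> F p * exp (e p)"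
    using eventually_valid
  proof eventually_elim
    case (elim p)
    then have "F p * 1 \<le> F p * exp (e p)"
      by (intro mult_left_mono) (auto simp: e_nonneg F_pos less_imp_le)
    then show ?case by simp
  qed
qed

lemma tendsto_P_X: "(P_X n k \<longlongrightarrow> 0) (at_right 0)"
proof -
  have "isCont (P_X n k) 0"
    by (rule DERIV_isCont[OF has_real_derivative_P_X]) (use k1 kn in auto)
  then have "(P_X n k \<longlongrightarrow> P_X n k 0) (at 0)" by (rule isContD)
  moreover have "P_X n k 0 = 0" unfolding P_X_def using k1 by (intro sum.neutral) auto
  ultimately show ?thesis by (simp add: filterlim_at_split)
qed

lemma tail_bounds:
  assumes "0 < \<phi>" "\<phi> < real k / real n"
  shows "F \<phi> \<le> P_X n k \<phi>" "P_X n k \<phi> \<le> F \<phi> * exp (e \<phi>)"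
proof -
  have R: "(P_X n k has_real_derivative real n * b p) (at p)" for p
    unfolding b_def using k1 kn by (intro has_real_derivative_P_X) auto
  have v: "p < real k / real n" if "p \<le> \<phi>" for p using that assms(2) by simp
  have "0 \<le> P_X n k \<phi> - F \<phi>"
  proof (rule nonneg_of_deriv_nonneg[where f = "\<lambda>p. P_X n k p - F p"
        and f' = "\<lambda>p. real n * b p - real n * b p * (1 - e p)", OF assms(1)])
    fix p assume p: "0 < p" "p \<le> \<phi>"
    show "((\<lambda>p. P_X n k p - F p) has_real_derivative real n * b p - real n * b p * (1 - e p)) (at p)"
      by (intro DERIV_diff R has_real_derivative_F p v)
    show "0 \<le> real n * b p - real n * b p * (1 - e p)"
      using e_nonneg[of p] b_pos[of p] p v by (simp add: algebra_simps)
  next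
    show "((\<lambda>p. P_X n k p - F p) \<longlongrightarrow> 0) (at_right 0)"
      using tendsto_diff[OF tendsto_P_X tendsto_F] by simp
  qed
  then show "F \<phi> \<le> P_X n k \<phi>" by simp
  have "0 \<le> F \<phi> * exp (e \<phi>) - P_X n k \<phi>"
  proof (rule nonneg_of_deriv_nonneg[where f = "\<lambda>p. F p * exp (e p) - P_X n k p"
        and f' = "\<lambda>p. real n * b p * (1 - e p) * exp (e p) + exp (e p) * e' p * F p - real n * b p", OF assms(1)])
    fix p assume p: "0 < p" "p \<le> \<phi>"
    note pv = p(1) v[OF p(2)]
    show "((\<lambda>p. F p * exp (e p) - P_X n k p) has_real_derivative
       real n * b p * (1 - e p) * exp (e p) + exp (e p) * e' p * F p - real n * b p) (at p)"
      by (intro DERIV_diff DERIV_mult R has_real_derivative_F pv DERIV_chain2[OF DERIV_exp] has_real_derivative_e)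
    \<comment> \<open>Since F = s b Y, this reads n b e^2 / 2 \<le> e' F. Hence the derivative of F
      exp e is at least n b exp e (1 - e + e^2 / 2), and so at least n b.\<close>
    have "b p * (real n * ((e p)\<^sup>2 / 2)) \<le> b p * (s p * Yfun (x p) * e' p)"
      using e'_bound[OF pv] b_pos[OF pv] by (intro mult_left_mono) auto
    then have 1: "real n * b p * (1 - e p + (e p)\<^sup>2 / 2) \<le> real n * b p * (1 - e p) + e' p * F p"
      by (simp add: F_def algebra_simps)
    have "real n * b p * 1 \<le> real n * b p * (exp (e p) * (1 - e p + (e p)\<^sup>2 / 2))"
      using exp_quadratic_ge_1[OF e_nonneg[OF pv]] b_pos[OF pv] by (intro mult_left_mono) auto
    also have "\<dots> = exp (e p) * (real n * b p * (1 - e p + (e p)\<^sup>2 / 2))" by simp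
    also have "\<dots> \<le> exp (e p) * (real n * b p * (1 - e p) + e' p * F p)"
      using 1 by (intro mult_left_mono) auto
    finally show "0 \<le> real n * b p * (1 - e p) * exp (e p) + exp (e p) * e' p * F p - real n * b p"
      by (simp add: algebra_simps)
  next
    show "((\<lambda>p. F p * exp (e p) - P_X n k p) \<longlongrightarrow> 0) (at_right 0)"
      using tendsto_diff[OF tendsto_F_exp_e tendsto_P_X] by simp
  qed
  then show "P_X n k \<phi> \<le> F \<phi> * exp (e \<phi>)" by simp
qed

end

section \<open>Passage to logarithms and substitution of Stirling's formula\<close>

theorem theorem7:
  fixes n k :: nat and \<phi> t :: real
  assumes "n \<ge> 1" and "0 < \<phi>" and "\<phi> < t" and "t < 1" and "t = real k / real n"
  defines "Z \<equiv> Yfun (sqrt (real n / (\<phi> * (1 - \<phi>))) * (t - \<phi>))"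
  shows "(- ln (P_PBR n k \<phi>) + ln (real n + 1) - ln (t * sqrt ((1 - \<phi>) / \<phi>))
           - ln (sqrt (real n) * Z) - lE n t \<phi> / (real n * (t - \<phi>))
         \<le> - ln (P_X n k \<phi>)
       \<and> - ln (P_X n k \<phi>)
         \<le> - ln (P_PBR n k \<phi>) + ln (real n + 1) - ln (t * sqrt ((1 - \<phi>) / \<phi>))
           - ln (sqrt (real n) * Z))
     \<and> (- ln (P_CH n k \<phi>) + ln (real n) / 2
           - ln (sqrt (t * (1 - \<phi>) / (2 * pi * (1 - t) * \<phi>)))
           - ln (sqrt (real n) * Z) - lE n t \<phi> / (real n * (t - \<phi>))
         \<le> - ln (P_X n k \<phi>)
       \<and> - ln (P_X n k \<phi>)
         \<le> - ln (P_CH n k \<phi>) + ln (real n) / 2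
           - ln (sqrt (t * (1 - \<phi>) / (2 * pi * (1 - t) * \<phi>)))
           - ln (sqrt (real n) * Z) + 1 / (12 * real n * t * (1 - t)))"
proof -
  define d where "d = \<phi> * (1 - \<phi>)"
  have n: "real n > 0" using assms(1) by simp
  have t0: "t > 0" using assms(2,3) by simp
  have k: "real k = real n * t" using n assms(5) by simp
  have "real k > 0" using n t0 by (simp add: k)
  then have k1: "1 \<le> k" by simp
  have "real k < real n" using assms(4) n by (simp add: k)
  then have kn: "k < n" by simp
  have \<phi>1: "\<phi> < 1" using assms(3,4) by simp
  have d: "d > 0" using assms(2) \<phi>1 by (simp add: d_def)
  interpret binomial_upper_tail n k by standard (fact k1 kn)+
  have pt: "\<phi> < real k / real n" using assms(3,5) by simp
  note pv = assms(2) pt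
  have s: "s \<phi> = sqrt (real n) * sqrt d" by (simp add: s_def d_def real_sqrt_mult)
  have sd: "sqrt (real n) > 0" "sqrt d > 0" using n d by auto
  have "sqrt (real n / d) * (t - \<phi>) = x \<phi>"
  proof -
    define a where "a = sqrt (real n)"
    have a: "a > 0" "real n = a * a" using n by (simp_all add: a_def)
    have "x \<phi> = (a * a * t - a * a * \<phi>) / (a * sqrt d)"
      unfolding x_def s k using a by simp
    also have "\<dots> = a / sqrt d * (t - \<phi>)" using a(1) sd(2) by (simp add: field_simps)
    finally show ?thesis by (simp add: a_def real_sqrt_divide)
  qed
  then have Z: "Z = Yfun (x \<phi>)" by (simp add: Z_def d_def)
  have Z0: "Z > 0" unfolding Z by (rule Yfun_pos)
  have c0: "real (n choose k) > 0" using kn by simp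
  define B where "B = real (n choose k) * \<phi> ^ k * (1 - \<phi>) ^ (n - k)"
  define r where "r = t * sqrt ((1 - \<phi>) / \<phi>)"
  have B0: "B > 0" using c0 assms(2) \<phi>1 by (simp add: B_def)
  have r0: "r > 0" using t0 assms(2) \<phi>1 by (simp add: r_def)
  \<comment> \<open>Absorption turns the coefficient in \<open>b\<close> into t (n choose k).
    Writing sqrt d as \<phi> sqrt ((1 - \<phi>) / \<phi>) supplies the missing power of
    \<phi>.\<close>
  have F: "F \<phi> = B * r * (sqrt (real n) * Z)"
  proof -
    have "real k * real (n choose k) = real n * real ((n - 1) choose (k - 1))"
      using k1 times_binomial_minus1_eq[of k n] by (metis of_nat_mult less_le_trans zero_less_one)
    then have c: "real ((n - 1) choose (k - 1)) = t * real (n choose k)" using n by (simp add: k)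
    have p: "\<phi> ^ k = \<phi> * \<phi> ^ (k - 1)" using k1 by (simp add: power_eq_if)
    have "sqrt d = \<phi> * sqrt ((1 - \<phi>) / \<phi>)"
    proof -
      have "\<phi> * sqrt ((1 - \<phi>) / \<phi>) = \<phi> / sqrt \<phi> * sqrt (1 - \<phi>)"
        by (simp add: real_sqrt_divide)
      also have "\<phi> / sqrt \<phi> = sqrt \<phi>" using assms(2) by (intro real_div_sqrt) simp
      finally show ?thesis by (simp add: d_def real_sqrt_mult)
    qed
    then show ?thesis unfolding F_def b_def s c Z B_def r_def p by simp
  qed
  \<comment> \<open>Because n (t - \<phi>) = x s, the claim is E x \<le> lE. The first argument of
    the minimum is sqrt (pi / 8) x, so the two upper bounds on E match its two arguments.\<close>
  have e: "e \<phi> \<le> lE n t \<phi> / (real n * (t - \<phi>))"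
  proof -
    have nt: "real n * (t - \<phi>) = x \<phi> * s \<phi>" using xs[OF pv] by (simp add: k algebra_simps)
    have "sqrt (pi * real n / (8 * \<phi> * (1 - \<phi>))) = sqrt (pi / 8) * sqrt (real n) / sqrt d"
      by (simp add: d_def real_sqrt_mult real_sqrt_divide mult.assoc)
    then have "(t - \<phi>) * sqrt (pi * real n / (8 * \<phi> * (1 - \<phi>))) = (t - \<phi>) * (sqrt (pi / 8) * sqrt (real n) / sqrt d)"
      by (simp only:)
    also have "\<dots> = sqrt (pi / 8) * (real n * (t - \<phi>)) / s \<phi>"
    proof -
      have "\<tau> * (c * a / g) = c * (a * a * \<tau>) / (a * g)" if "a \<noteq> 0" for a c g \<tau> :: real
        using that by simp
      from this[of "sqrt (real n)" "t - \<phi>" "sqrt (pi / 8)" "sqrt d"] show ?thesis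
        using sd n by (simp add: s)
    qed
    also have "\<dots> = sqrt (pi / 8) * x \<phi>" unfolding nt using s_pos[OF pv] by simp
    finally have "lE n t \<phi> = min (sqrt (pi / 8) * x \<phi>) 1" by (simp add: lE_def)
    moreover have "E \<phi> * x \<phi> \<le> sqrt (pi / 8) * x \<phi>"
      using E_bounds(2)[OF pv] x_pos[OF pv] by (intro mult_right_mono) auto
    moreover have "E \<phi> * x \<phi> \<le> 1"
      using E_bounds(3)[OF pv] x_pos[OF pv] by (simp add: le_divide_eq)
    ultimately have "E \<phi> * x \<phi> \<le> lE n t \<phi>" by simp
    then show ?thesis
      unfolding nt using x_pos[OF pv] s_pos[OF pv] by (simp add: e_def field_simps)
  qed
  have PX: "P_X n k \<phi> > 0" using tail_bounds(1)[OF pv] F_pos[OF pv] by simp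
  have lnF: "ln (F \<phi>) = ln B + ln r + ln (sqrt (real n) * Z)"
    unfolding F using B0 r0 sd Z0 by (simp add: ln_mult)
  have lower: "ln (F \<phi>) \<le> ln (P_X n k \<phi>)"
    using tail_bounds(1)[OF pv] F_pos[OF pv] by simp
  have "ln (P_X n k \<phi>) \<le> ln (F \<phi> * exp (e \<phi>))"
    using tail_bounds(2)[OF pv] PX by simp
  also have "\<dots> = ln (F \<phi>) + e \<phi>" using F_pos[OF pv] by (simp add: ln_mult)
  finally have upper: "ln (P_X n k \<phi>) \<le> ln (F \<phi>) + lE n t \<phi> / (real n * (t - \<phi>))" using e by simp
  have "P_PBR n k \<phi> = B * (real n + 1)"
    using pt by (simp add: P_PBR_def B_def)
  then have PBR: "ln (P_PBR n k \<phi>) = ln B + ln (real n + 1)"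
    using B0 n by (simp add: ln_mult)
  have m: "real n * (1 - t) = real (n - k)" using kn by (simp add: k algebra_simps of_nat_diff)
  have CH: "ln (P_CH n k \<phi>) = real k * (ln \<phi> - ln t) + real (n - k) * (ln (1 - \<phi>) - ln (1 - t))"
  proof -
    have "P_CH n k \<phi> = (\<phi> / t) powr (real n * t) * ((1 - \<phi>) / (1 - t)) powr (real n * (1 - t))"
      using assms(3) by (simp add: P_CH_def assms(5)[symmetric])
    then show ?thesis
      using assms(2,4) \<phi>1 t0 unfolding m k[symmetric] by (simp add: ln_mult ln_powr ln_div)
  qed
  \<comment> \<open>The total Stirling error of the binomial coefficient. Its sign gives the lower
    end of the second interval, its upper bound the upper end.\<close>
  define \<rho> where "\<rho> = stirling_rem k + stirling_rem (n - k) - stirling_rem n"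
  have "ln (real (n choose k) * t ^ k * (1 - t) ^ (n - k)) = - \<rho> - ln (2 * pi * real n * t * (1 - t)) / 2"
    using ln_binomial_peak[OF k1 kn] by (simp add: assms(5)[symmetric] \<rho>_def)
  then have "ln (real (n choose k)) + real k * ln t + real (n - k) * ln (1 - t)
      = - \<rho> - (ln (2 * pi) + ln (real n) + ln t + ln (1 - t)) / 2"
    using c0 t0 assms(4) n by (simp add: ln_mult ln_realpow)
  moreover have "ln B = ln (real (n choose k)) + real k * ln \<phi> + real (n - k) * ln (1 - \<phi>)"
    using c0 assms(2) \<phi>1 by (simp add: B_def ln_mult ln_realpow)
  ultimately have "ln B = ln (P_CH n k \<phi>) - \<rho> - (ln (2 * pi) + ln (real n) + ln t + ln (1 - t)) / 2"
    unfolding CH by (simp add: algebra_simps)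
  moreover have "ln r = ln t + (ln (1 - \<phi>) - ln \<phi>) / 2"
    using t0 assms(2) \<phi>1 by (simp add: r_def ln_mult ln_sqrt ln_div)
  moreover have "ln (sqrt (t * (1 - \<phi>) / (2 * pi * (1 - t) * \<phi>)))
      = (ln t + ln (1 - \<phi>) - ln (2 * pi) - ln (1 - t) - ln \<phi>) / 2"
    using t0 assms(2,4) \<phi>1 by (simp add: ln_mult ln_sqrt ln_div)
  ultimately have BCH: "ln B + ln r = ln (P_CH n k \<phi>) - ln (real n) / 2
      + ln (sqrt (t * (1 - \<phi>) / (2 * pi * (1 - t) * \<phi>))) - \<rho>"
    by (simp add: field_simps)
  have "0 \<le> \<rho>" "\<rho> \<le> 1 / (12 * real n * t * (1 - t))"
    using stirling_rem_binomial_bounds[OF k1 kn] by (simp_all add: \<rho>_def assms(5)[symmetric])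
  then show ?thesis
    using lower upper lnF PBR BCH unfolding r_def[symmetric] by linarith
qed

end
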